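(* Let $g:\mathbb{R}\to\mathbb{R}$ satisfy: (1) $g\in C^{10}(\mathbb{R})$ and $g''$ is bounded on $\mathbb{R}$; (2) there exist constants $C,\kappa$ such that $|g^{(i)}(t)|\le C(1+|t|^\kappa)$ for all $t\in\mathbb{R}$ and $i=1,\dots,10$; (3) $\int_{\mathbb{R}} t^k e^{g(t)}\,dt<+\infty$ for all $k\in\mathbb{N}$. Let $\ell>0$, let $h_d=\ell^2 d^{-1/5}$, and let $a_d^{\mathrm{fM}}(\ell)$ be the mean acceptance rate at stationarity of the fMALA algorithm with step $h_d$ for the product target $\pi_d(x)=Z_d\prod_{i=1}^d e^{g(x_i)}$ on $\mathbb{R}^d$. Then $$\lim_{d\to+\infty} a_d^{\mathrm{fM}}(\ell)=a^{\mathrm{fM}}(\ell),\qquad a^{\mathrm{fM}}(\ell)=2\,\Phi\!\left(-K^{\mathrm{fM}}\ell^5/2\right),$$ where $\Phi(t)=\frac{1}{\sqrt{2\pi}}\int_{-\infty}^t e^{-s^2/2}\,ds$ and $K^{\mathrm{fM}}$ is the constant depending only on $g$ defined in the context.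
   Context: Target: $\pi_d(x)=Z_d\prod_{i=1}^d e^{g(x_i)}$, $x\in\mathbb{R}^d$, with $Z_d$ the normalising constant; $\pi_1$ is the one-dimensional density proportional to $e^{g}$. fMALA proposal (with $\Sigma=\mathrm{I}_d$): from $x\in\mathbb{R}^d$ the proposal $y$ has independent coordinates $$y_i=x_i+\frac{h_d}{2}g'(x_i)-\frac{h_d^2}{24}\left(g''(x_i)g'(x_i)+g^{(3)}(x_i)\right)+\left(h_d^{1/2}+\frac{h_d^{3/2}}{12}g''(x_i)\right)\xi_i,\quad i=1,\dots,d,$$ with $\xi_1,\dots,\xi_d$ i.i.d. standard Gaussian. (Since $g''$ is bounded, the coefficient of $\xi_i$ is positive for all $x$ once $d$ is large enough.) Let $q_d^{\mathrm{fM}}(x,y)$ be the transition density of this proposal, and $$\alpha_d^{\mathrm{fM}}(x,y)=\min\left(1,\frac{\pi_d(y)q_d^{\mathrm{fM}}(y,x)}{\pi_d(x)q_d^{\mathrm{fM}}(x,y)}\right),\qquad a_d^{\mathrm{fM}}(\ell)=\int_{\mathbb{R}^d}\int_{\mathbb{R}^d}\pi_d(x)q_d^{\mathrm{fM}}(x,y)\alpha_d^{\mathrm{fM}}(x,y)\,dx\,dy .$$ Constant: let $X\sim\pi_1$ and let $\xi$ be a standard Gaussian independent of $X$. Define $$c^{\mathrm{fM}}(x,\xi)=\tfrac{1}{720}\Big(\xi^5 g^{(5)}(x)+5\xi^3 g^{(5)}(x)+15\xi^3 g^{(4)}(x)g'(x)+15\xi g^{(4)}(x)g'(x)+30\xi^3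 g^{(3)}(x)g''(x)+10\xi g^{(3)}(x)g''(x)+30\xi g^{(3)}(x)g'(x)^2+35\xi g'(x)g''(x)^2\Big),$$ and $K^{\mathrm{fM}}=\left(\mathbb{E}[c^{\mathrm{fM}}(X,\xi)^2]\right)^{1/2}\ge 0$. *)

theory Defs
  imports "HOL-Probability.Probability"
begin

definition Ck_real :: "nat \<Rightarrow> (real \<Rightarrow> real) \<Rightarrow> bool" where
  "Ck_real k g \<longleftrightarrow>
     (\<forall>i<k. (deriv ^^ i) g differentiable_on UNIV) \<and> continuous_on UNIV ((deriv ^^ k) g)"

text \<open>
  Since the dimension d tends to infinity, a point of d-dimensional space is a function
  \<^typ>\<open>nat \<Rightarrow> real\<close> of which only the coordinates with index below d matter (so coordinates
  are numbered from 0), and Lebesgue measure is the d-fold product of \<^term>\<open>lborel\<close>.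
\<close>

abbreviation lborel_pow :: "nat \<Rightarrow> (nat \<Rightarrow> real) measure" where
  "lborel_pow d \<equiv> Pi\<^sub>M {..<d} (\<lambda>_. lborel)"

definition target_const :: "(real \<Rightarrow> real) \<Rightarrow> nat \<Rightarrow> real" where
  "target_const g d = 1 / (\<integral>x. (\<Prod>i<d. exp (g (x i))) \<partial>lborel_pow d)"

definition target_density :: "(real \<Rightarrow> real) \<Rightarrow> nat \<Rightarrow> (nat \<Rightarrow> real) \<Rightarrow> real" where
  "target_density g d x = target_const g d * (\<Prod>i<d. exp (g (x i)))"

definition target1_density :: "(real \<Rightarrow> real) \<Rightarrow> real \<Rightarrow> real" where
  "target1_density g t = exp (g t) / (\<integral>s. exp (g s) \<partial>lborel)"

definition fmala_mean :: "(real \<Rightarrow> real) \<Rightarrow> real \<Rightarrow> real \<Rightarrow> real" where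
  "fmala_mean g h t =
     t + h / 2 * deriv g t - h\<^sup>2 / 24 * ((deriv ^^ 2) g t * deriv g t + (deriv ^^ 3) g t)"

definition fmala_scale :: "(real \<Rightarrow> real) \<Rightarrow> real \<Rightarrow> real \<Rightarrow> real" where
  "fmala_scale g h t = h powr (1/2) + h powr (3/2) / 12 * (deriv ^^ 2) g t"

definition fmala_proposal ::
  "(real \<Rightarrow> real) \<Rightarrow> real \<Rightarrow> nat \<Rightarrow> (nat \<Rightarrow> real) \<Rightarrow> (nat \<Rightarrow> real) \<Rightarrow> (nat \<Rightarrow> real)" where
  "fmala_proposal g h d x \<xi> = (\<lambda>i\<in>{..<d}. fmala_mean g h (x i) + fmala_scale g h (x i) * \<xi> i)"

text \<open>
  The proposal density. It is the Lebesgue density of the law of \<open>fmala_proposal g h d x \<xi>\<close>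
  for i.i.d. standard Gaussian \<open>\<xi> i\<close> whenever the scales are nonzero, see
  \<open>distr_fmala_proposal\<close> below. If some scale vanishes, which happens at most for large h when
  the second derivative of g is bounded, the law has no density and the value here is 0.
\<close>

definition fmala_density ::
  "(real \<Rightarrow> real) \<Rightarrow> real \<Rightarrow> nat \<Rightarrow> (nat \<Rightarrow> real) \<Rightarrow> (nat \<Rightarrow> real) \<Rightarrow> real" where
  "fmala_density g h d x y =
     (\<Prod>i<d. normal_density (fmala_mean g h (x i)) (fmala_scale g h (x i)) (y i))"

lemma distr_std_normal_affine:
  assumes "\<sigma> \<noteq> 0"
  shows "distr std_normal_distribution lborel (\<lambda>t. \<mu> + \<sigma> * t) = density lborel (normal_density \<mu> \<sigma>)"
proof -
  interpret prob_space std_normal_distribution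
    by (rule prob_space_normal_density) simp
  have "distributed std_normal_distribution lborel (\<lambda>t. t) std_normal_density"
    by (simp add: distributed_def distr_id2)
  from normal_density_affine[OF this zero_less_one assms, of \<mu>]
  have "distributed std_normal_distribution lborel (\<lambda>t. \<mu> + \<sigma> * t) (normal_density \<mu> \<bar>\<sigma>\<bar>)"
    by simp
  then show ?thesis
    by (simp add: distributed_def normal_density_def)
qed

lemma distr_fmala_proposal:
  assumes nz: "\<And>i. i < d \<Longrightarrow> fmala_scale g h (x i) \<noteq> 0"
  shows "distr (Pi\<^sub>M {..<d} (\<lambda>_. std_normal_distribution)) (lborel_pow d) (fmala_proposal g h d x)
       = density (lborel_pow d) (fmala_density g h d x)"
proof -
  let ?m = "\<lambda>i. fmala_mean g h (x i)" and ?s = "\<lambda>i. fmala_scale g h (x i)"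
  let ?N = "\<lambda>i. density lborel (normal_density (?m i) (?s i))"
  let ?A = "\<lambda>i t. ?m i + ?s i * t"
  have ps: "prob_space (density lborel (normal_density \<mu> \<sigma>))" if "\<sigma> \<noteq> 0" for \<mu> \<sigma> :: real
    unfolding distr_std_normal_affine[OF that, symmetric]
    by (intro prob_space.prob_space_distr prob_space_normal_density) auto
  have sf: "sigma_finite_measure (density lborel (normal_density \<mu> \<sigma>))" for \<mu> \<sigma> :: real
  proof (cases "\<sigma> = 0")
    case True
    then have "emeasure (density lborel (normal_density \<mu> \<sigma>)) UNIV = 0"
      by (simp add: emeasure_density normal_density_def)
    then show ?thesis
      by (intro finite_measure.axioms(1) finite_measureI) simp
  next
    case False
    then show ?thesis
      using ps prob_space_imp_sigma_finite by blast
  qed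
  interpret N: product_sigma_finite ?N
    by (simp add: product_sigma_finite_def sf)
  interpret G: product_sigma_finite "\<lambda>_::nat. std_normal_distribution"
    by (simp add: product_sigma_finite_def sf)
  interpret L: product_sigma_finite "\<lambda>_::nat. lborel :: real measure"
    by (simp add: product_sigma_finite_def sigma_finite_lborel)
  have sets_N: "sets (Pi\<^sub>M {..<d} ?N) = sets (lborel_pow d)"
    by (intro sets_PiM_cong) auto
  have sets_G: "sets (Pi\<^sub>M {..<d} (\<lambda>_. std_normal_distribution)) = sets (lborel_pow d)"
    by (intro sets_PiM_cong) auto
  have meas: "fmala_proposal g h d x \<in> measurable (Pi\<^sub>M {..<d} (\<lambda>_. std_normal_distribution)) (lborel_pow d)"
    unfolding measurable_cong_sets[OF sets_G refl] fmala_proposal_def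
    by (intro measurable_restrict) measurable
  have "distr (Pi\<^sub>M {..<d} (\<lambda>_. std_normal_distribution)) (lborel_pow d) (fmala_proposal g h d x)
      = Pi\<^sub>M {..<d} ?N"
  proof (rule N.PiM_eqI)
    fix A assume "\<And>i. i \<in> {..<d} \<Longrightarrow> A i \<in> sets (?N i)"
    then have A: "\<And>i. i < d \<Longrightarrow> A i \<in> sets borel" by auto
    have PA: "Pi\<^sub>E {..<d} A \<in> sets (lborel_pow d)"
      using A by (intro sets_PiM_I_finite) auto
    have pre: "fmala_proposal g h d x -` Pi\<^sub>E {..<d} A \<inter> space (Pi\<^sub>M {..<d} (\<lambda>_. std_normal_distribution))
        = Pi\<^sub>E {..<d} (\<lambda>i. ?A i -` A i)"
      by (auto simp: fmala_proposal_def space_PiM PiE_iff extensional_def restrict_def)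
    have Am: "?A i -` A i \<in> sets borel" if "i < d" for i
      using measurable_sets[of "?A i" borel borel "A i"] A[OF that] by simp
    have "emeasure (distr (Pi\<^sub>M {..<d} (\<lambda>_. std_normal_distribution)) (lborel_pow d)
             (fmala_proposal g h d x)) (Pi\<^sub>E {..<d} A)
        = (\<Prod>i<d. emeasure std_normal_distribution (?A i -` A i))"
      unfolding emeasure_distr[OF meas PA] pre
      by (subst G.emeasure_PiM) (auto simp: Am)
    also have "\<dots> = (\<Prod>i<d. emeasure (?N i) (A i))"
    proof (rule prod.cong[OF refl])
      fix i assume "i \<in> {..<d}"
      then have i: "i < d" by simp
      show "emeasure std_normal_distribution (?A i -` A i) = emeasure (?N i) (A i)"
        unfolding distr_std_normal_affine[OF nz[OF i], of "?m i", symmetric]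
        using A[OF i] by (subst emeasure_distr) auto
    qed
    finally show "emeasure (distr (Pi\<^sub>M {..<d} (\<lambda>_. std_normal_distribution)) (lborel_pow d)
             (fmala_proposal g h d x)) (Pi\<^sub>E {..<d} A) = (\<Prod>i<d. emeasure (?N i) (A i))" .
  qed (auto simp: sets_N)
  also have "\<dots> = density (lborel_pow d) (fmala_density g h d x)"
  proof (rule N.PiM_eqI[symmetric])
    fix A assume "\<And>i. i \<in> {..<d} \<Longrightarrow> A i \<in> sets (?N i)"
    then have A: "\<And>i. i < d \<Longrightarrow> A i \<in> sets borel" by auto
    have PA: "Pi\<^sub>E {..<d} A \<in> sets (lborel_pow d)"
      using A by (intro sets_PiM_I_finite) auto
    have fm: "(\<lambda>y. ennreal (fmala_density g h d x y)) \<in> borel_measurable (lborel_pow d)"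
      unfolding fmala_density_def by measurable
    have "emeasure (density (lborel_pow d) (fmala_density g h d x)) (Pi\<^sub>E {..<d} A)
        = (\<integral>\<^sup>+y. ennreal (fmala_density g h d x y) * indicator (Pi\<^sub>E {..<d} A) y \<partial>lborel_pow d)"
      by (rule emeasure_density[OF fm PA])
    also have "\<dots> = (\<integral>\<^sup>+y. (\<Prod>i<d. ennreal (normal_density (?m i) (?s i) (y i)) * indicator (A i) (y i)) \<partial>lborel_pow d)"
    proof (rule nn_integral_cong)
      fix y assume "y \<in> space (lborel_pow d)"
      then have "indicator (Pi\<^sub>E {..<d} A) y = (\<Prod>i<d. indicator (A i) (y i) :: ennreal)"
        by (auto simp: indicator_def space_PiM PiE_iff)
      then show "ennreal (fmala_density g h d x y) * indicator (Pi\<^sub>E {..<d} A) y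
          = (\<Prod>i<d. ennreal (normal_density (?m i) (?s i) (y i)) * indicator (A i) (y i))"
        by (simp add: fmala_density_def prod_ennreal prod.distrib)
    qed
    also have "\<dots> = (\<Prod>i<d. \<integral>\<^sup>+t. ennreal (normal_density (?m i) (?s i) t) * indicator (A i) t \<partial>lborel)"
      using A by (intro L.product_nn_integral_prod) auto
    also have "\<dots> = (\<Prod>i<d. emeasure (?N i) (A i))"
      using A by (intro prod.cong) (auto simp: emeasure_density)
    finally show "emeasure (density (lborel_pow d) (fmala_density g h d x)) (Pi\<^sub>E {..<d} A)
        = (\<Prod>i<d. emeasure (?N i) (A i))" .
  qed (auto simp: sets_N)
  finally show ?thesis .
qed

definition fmala_acc ::
  "(real \<Rightarrow> real) \<Rightarrow> real \<Rightarrow> nat \<Rightarrow> (nat \<Rightarrow> real) \<Rightarrow> (nat \<Rightarrow> real) \<Rightarrow> real" where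
  "fmala_acc g h d x y =
     min 1 ((target_density g d y * fmala_density g h d y x) /
            (target_density g d x * fmala_density g h d x y))"

definition fmala_step :: "real \<Rightarrow> nat \<Rightarrow> real" where
  "fmala_step l d = l\<^sup>2 * real d powr (- 1 / 5)"

definition fmala_mean_acc :: "(real \<Rightarrow> real) \<Rightarrow> real \<Rightarrow> nat \<Rightarrow> real" where
  "fmala_mean_acc g l d =
     (\<integral>x. (\<integral>y. target_density g d x * fmala_density g (fmala_step l d) d x y *
                fmala_acc g (fmala_step l d) d x y \<partial>lborel_pow d) \<partial>lborel_pow d)"

definition c_fM :: "(real \<Rightarrow> real) \<Rightarrow> real \<Rightarrow> real \<Rightarrow> real" where
  "c_fM g x \<xi> = 1 / 720 *
     (\<xi>^5 * (deriv ^^ 5) g x + 5 * \<xi>^3 * (deriv ^^ 5) g x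
      + 15 * \<xi>^3 * (deriv ^^ 4) g x * deriv g x + 15 * \<xi> * (deriv ^^ 4) g x * deriv g x
      + 30 * \<xi>^3 * (deriv ^^ 3) g x * (deriv ^^ 2) g x + 10 * \<xi> * (deriv ^^ 3) g x * (deriv ^^ 2) g x
      + 30 * \<xi> * (deriv ^^ 3) g x * (deriv g x)\<^sup>2 + 35 * \<xi> * deriv g x * ((deriv ^^ 2) g x)\<^sup>2)"

text \<open>The product measure is the joint law of the independent pair \<open>(X, \<xi>)\<close>.\<close>

definition K_fM :: "(real \<Rightarrow> real) \<Rightarrow> real" where
  "K_fM g = sqrt (\<integral>(x, \<xi>). (c_fM g x \<xi>)\<^sup>2
     \<partial>(density lborel (target1_density g) \<Otimes>\<^sub>M std_normal_distribution))"

definition Phi :: "real \<Rightarrow> real" where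
  "Phi t = 1 / sqrt (2 * pi) * (LBINT s:{..t}. exp (- s\<^sup>2 / 2))"

end

theory Submission
  imports Defs
begin

text \<open>
  Write \<open>h = \<epsilon>\<^sup>2\<close>. Target and proposal are products, so the logarithm of the acceptance ratio in
  dimension \<open>d\<close> is a sum of \<open>d\<close> independent copies of the log ratio \<open>R\<close> of a single coordinate
  \<open>(x, y)\<close>, where \<open>x\<close> has density proportional to \<open>exp g\<close> and \<open>y\<close> is the move from \<open>x\<close> with
  noise \<open>\<xi>\<close>. The proof is a central limit theorem for this sum, driven by two facts on \<open>R\<close>.

  Expansion. The drift and the scale of fMALA are chosen so that the terms of order \<open>0\<close> to \<open>4\<close> in
  \<open>\<epsilon>\<close> of \<open>R\<close> cancel; what is left is \<open>R = \<epsilon>\<^sup>5 c(x, \<xi>) + O(\<epsilon>\<^sup>6)\<close>, with a remainder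
  dominated by a polynomial in \<open>\<bar>x\<bar>\<close> and \<open>\<bar>\<xi>\<bar>\<close> (\<open>log_ratio_expansion\<close>). The expansion is
  computed with truncated power series in \<open>\<epsilon>\<close> whose remainders are controlled in this sense.

  Reversibility. Exchanging \<open>x\<close> and \<open>y\<close> turns \<open>R\<close> into \<open>-R\<close> and multiplies the density of the pair
  by \<open>exp R\<close>. Hence \<open>E[\<phi>(R)] = E[exp(R) \<phi>(-R)]\<close> (\<open>integral_pair_law_swap\<close>). Averaging both
  sides for the truncation of \<open>\<phi>(r) = exp(itr) - 1\<close> to \<open>\<bar>r\<bar> \<le> 1\<close> cancels the linear term and leaves a
  function equal to \<open>-(t\<^sup>2 + it) r\<^sup>2 / 2 + O(\<bar>r\<bar>\<^sup>3)\<close>. So the mean of \<open>R\<close>, which is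
  of the order \<open>\<epsilon>\<^sup>1\<^sup>0\<close> and would otherwise need an expansion of \<open>R\<close> to that order, is determined by the
  leading term alone: it is minus half the variance (\<open>one_coordinate_char\<close>).

  With \<open>\<epsilon> = l d\<^bsup>-1/10\<^esup>\<close> one has \<open>d \<epsilon>\<^sup>1\<^sup>0 = l\<^sup>1\<^sup>0\<close>, so the \<open>d\<close>-th power of the
  characteristic function of \<open>R\<close> converges to the characteristic function of a Gaussian with variance \<open>\<sigma>\<^sup>2\<close> and
  mean \<open>-\<sigma>\<^sup>2/2\<close>, where \<open>\<sigma> = K l\<^sup>5\<close>. By Levy's continuity theorem the sum converges in law to this
  Gaussian \<open>S\<close>. The mean acceptance rate is the expectation of the bounded continuous function \<open>min(1, exp s)\<close>
  of the sum, and \<open>E[min(1, exp S)] = 2 \<Phi>(-\<sigma>/2)\<close>.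
\<close>

section \<open>Expansions in \<open>\<epsilon>\<close> with polynomially bounded remainders\<close>

text \<open>
  A point \<open>p = (x, z)\<close> consists of the current state and the noise. The product form makes every
  power of the weight integrable as soon as \<open>x\<close> and \<open>z\<close> separately have all moments.
\<close>

definition weight :: "real \<times> real \<Rightarrow> real" where
  "weight p = (1 + \<bar>fst p\<bar>) * (1 + \<bar>snd p\<bar>)"

text \<open>
  At most polynomial growth in the point, uniformly for all sufficiently small \<open>\<epsilon>\<close>. How small may
  depend on the function but not on the point, so that such bounds can be integrated.
\<close>

definition tame :: "(real \<Rightarrow> real \<times> real \<Rightarrow> real) \<Rightarrow> bool" where
  "tame f \<longleftrightarrow> (\<exists>C n. \<forall>\<^sub>F \<epsilon> in at_right 0. \<forall>p. \<bar>f \<epsilon> p\<bar> \<le> C * weight p ^ n)"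

lemma weight_ge_1: "1 \<le> weight p"
  using mult_mono[of 1 "1 + \<bar>fst p\<bar>" 1 "1 + \<bar>snd p\<bar>"] by (simp add: weight_def)

lemma eventually_at_right_0_small: "0 < (c::real) \<Longrightarrow> \<forall>\<^sub>F \<epsilon> in at_right 0. 0 < \<epsilon> \<and> \<epsilon> < c"
  by (rule eventually_at_rightI[of 0 c]) auto

lemma tame_mono:
  assumes "tame f" "\<forall>\<^sub>F \<epsilon> in at_right 0. \<forall>p. \<bar>h \<epsilon> p\<bar> \<le> D * \<bar>f \<epsilon> p\<bar>"
  shows "tame h"
proof -
  obtain C n where C: "\<forall>\<^sub>F \<epsilon> in at_right 0. \<forall>p. \<bar>f \<epsilon> p\<bar> \<le> C * weight p ^ n"
    using assms(1) unfolding tame_def by blast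
  have "\<forall>\<^sub>F \<epsilon> in at_right 0. \<forall>p. \<bar>h \<epsilon> p\<bar> \<le> (\<bar>D\<bar> * C) * weight p ^ n"
    using C assms(2)
  proof eventually_elim
    case (elim \<epsilon>)
    show ?case
    proof
      fix p
      have "\<bar>h \<epsilon> p\<bar> \<le> D * \<bar>f \<epsilon> p\<bar>" using elim by blast
      also have "\<dots> \<le> \<bar>D\<bar> * \<bar>f \<epsilon> p\<bar>" by (intro mult_right_mono) auto
      also have "\<dots> \<le> \<bar>D\<bar> * (C * weight p ^ n)" using elim(1) by (intro mult_left_mono abs_ge_zero) blast
      finally show "\<bar>h \<epsilon> p\<bar> \<le> (\<bar>D\<bar> * C) * weight p ^ n" by (simp add: mult_ac)
    qed
  qed
  then show ?thesis unfolding tame_def by blast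
qed

lemma tame_cong: "\<forall>\<^sub>F \<epsilon> in at_right 0. f \<epsilon> = h \<epsilon> \<Longrightarrow> tame f \<Longrightarrow> tame h"
  by (rule tame_mono[where D = 1 and f = f]) (auto elim: eventually_mono)

lemma tame_bounded: "\<forall>\<^sub>F \<epsilon> in at_right 0. \<forall>p. \<bar>f \<epsilon> p\<bar> \<le> D \<Longrightarrow> tame f"
  unfolding tame_def by (rule exI[of _ D], rule exI[of _ 0]) simp

lemma tame_const [simp]: "tame (\<lambda>\<epsilon> p. c)"
  by (rule tame_bounded[of _ "\<bar>c\<bar>"]) simp

lemma tame_fst [simp]: "tame (\<lambda>\<epsilon> p. fst p)"
  unfolding tame_def
proof (rule exI[of _ 1], rule exI[of _ 1], intro always_eventually allI)
  fix p :: "real \<times> real"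
  have "(1 + \<bar>fst p\<bar>) * 1 \<le> (1 + \<bar>fst p\<bar>) * (1 + \<bar>snd p\<bar>)"
    by (rule mult_left_mono) auto
  then show "\<bar>fst p\<bar> \<le> 1 * weight p ^ 1" by (simp add: weight_def)
qed

lemma tame_snd [simp]: "tame (\<lambda>\<epsilon> p. snd p)"
  unfolding tame_def
proof (rule exI[of _ 1], rule exI[of _ 1], intro always_eventually allI)
  fix p :: "real \<times> real"
  have "1 * (1 + \<bar>snd p\<bar>) \<le> (1 + \<bar>fst p\<bar>) * (1 + \<bar>snd p\<bar>)"
    by (rule mult_right_mono) auto
  then show "\<bar>snd p\<bar> \<le> 1 * weight p ^ 1" by (simp add: weight_def)
qed

lemma tame_eps [simp]: "tame (\<lambda>\<epsilon> p. \<epsilon>)"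
  using eventually_at_right_0_small[of 1]
  by (intro tame_bounded[of _ 1]) (auto elim!: eventually_mono)

lemma tame_mult:
  assumes "tame f" "tame h" shows "tame (\<lambda>\<epsilon> p. f \<epsilon> p * h \<epsilon> p)"
proof -
  obtain C n where C: "\<forall>\<^sub>F \<epsilon> in at_right 0. \<forall>p. \<bar>f \<epsilon> p\<bar> \<le> C * weight p ^ n"
    using assms(1) unfolding tame_def by blast
  obtain D m where D: "\<forall>\<^sub>F \<epsilon> in at_right 0. \<forall>p. \<bar>h \<epsilon> p\<bar> \<le> D * weight p ^ m"
    using assms(2) unfolding tame_def by blast
  have "\<forall>\<^sub>F \<epsilon> in at_right 0. \<forall>p. \<bar>f \<epsilon> p * h \<epsilon> p\<bar> \<le> (C * D) * weight p ^ (n + m)"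
    using C D
  proof eventually_elim
    case (elim \<epsilon>)
    show ?case
    proof
      fix p
      have "\<bar>f \<epsilon> p\<bar> * \<bar>h \<epsilon> p\<bar> \<le> (C * weight p ^ n) * (D * weight p ^ m)"
        using elim abs_ge_zero order_trans by (intro mult_mono) blast+
      then show "\<bar>f \<epsilon> p * h \<epsilon> p\<bar> \<le> (C * D) * weight p ^ (n + m)"
        by (simp add: abs_mult power_add mult_ac)
    qed
  qed
  then show ?thesis unfolding tame_def by blast
qed

lemma tame_add:
  assumes "tame f" "tame h" shows "tame (\<lambda>\<epsilon> p. f \<epsilon> p + h \<epsilon> p)"
proof -
  obtain C n where C: "\<forall>\<^sub>F \<epsilon> in at_right 0. \<forall>p. \<bar>f \<epsilon> p\<bar> \<le> C * weight p ^ n"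
    using assms(1) unfolding tame_def by blast
  obtain D m where D: "\<forall>\<^sub>F \<epsilon> in at_right 0. \<forall>p. \<bar>h \<epsilon> p\<bar> \<le> D * weight p ^ m"
    using assms(2) unfolding tame_def by blast
  have "\<forall>\<^sub>F \<epsilon> in at_right 0. \<forall>p. \<bar>f \<epsilon> p + h \<epsilon> p\<bar> \<le> (\<bar>C\<bar> + \<bar>D\<bar>) * weight p ^ (n + m)"
    using C D
  proof eventually_elim
    case (elim \<epsilon>)
    show ?case
    proof
      fix p
      have w: "weight p ^ n \<le> weight p ^ (n + m)" "weight p ^ m \<le> weight p ^ (n + m)"
        using weight_ge_1[of p] by (auto intro: power_increasing)
      have p: "0 \<le> weight p ^ n" "0 \<le> weight p ^ m"
        using weight_ge_1[of p] by auto
      have "\<bar>f \<epsilon> p\<bar> \<le> C * weight p ^ n" "\<bar>h \<epsilon> p\<bar> \<le> D * weight p ^ m"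
        using elim by blast+
      moreover have "C * weight p ^ n \<le> \<bar>C\<bar> * weight p ^ (n + m)"
        using w p by (intro mult_mono) auto
      moreover have "D * weight p ^ m \<le> \<bar>D\<bar> * weight p ^ (n + m)"
        using w p by (intro mult_mono) auto
      ultimately show "\<bar>f \<epsilon> p + h \<epsilon> p\<bar> \<le> (\<bar>C\<bar> + \<bar>D\<bar>) * weight p ^ (n + m)"
        by (simp add: algebra_simps abs_le_iff)
    qed
  qed
  then show ?thesis unfolding tame_def by blast
qed

lemma tame_cmult: "tame f \<Longrightarrow> tame (\<lambda>\<epsilon> p. c * f \<epsilon> p)"
  using tame_mult[OF tame_const] by blast

lemma tame_uminus: "tame f \<Longrightarrow> tame (\<lambda>\<epsilon> p. - f \<epsilon> p)"
  using tame_cmult[of f "-1"] by simp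

lemma tame_diff: "tame f \<Longrightarrow> tame h \<Longrightarrow> tame (\<lambda>\<epsilon> p. f \<epsilon> p - h \<epsilon> p)"
  using tame_add[of f "\<lambda>\<epsilon> p. (-1) * h \<epsilon> p"] tame_cmult[of h "-1"] by simp

lemma tame_divide: "tame f \<Longrightarrow> tame (\<lambda>\<epsilon> p. f \<epsilon> p / c)"
  using tame_cmult[of f "1 / c"] by simp

lemma tame_power: "tame f \<Longrightarrow> tame (\<lambda>\<epsilon> p. f \<epsilon> p ^ k)"
  by (induction k) (simp_all add: tame_mult)

lemmas tame_intros = tame_mult tame_add tame_diff tame_divide tame_power tame_uminus

text \<open>
  The point \<open>t\<close> at which \<open>\<phi>\<close> is evaluated is only required to exist. This is what a Lagrange
  remainder provides, where the intermediate point is known only through a bound.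
\<close>

lemma tame_compose_poly_growth:
  assumes "\<And>t. \<bar>\<phi> t\<bar> \<le> C * (1 + \<bar>t\<bar>) ^ n" and "tame f"
    and "\<forall>\<^sub>F \<epsilon> in at_right 0. \<forall>p. \<exists>t. r \<epsilon> p = \<phi> t \<and> \<bar>t\<bar> \<le> \<bar>f \<epsilon> p\<bar>"
  shows "tame r"
proof -
  have "tame (\<lambda>\<epsilon> p. (\<bar>C\<bar> * (1 + \<bar>f \<epsilon> p\<bar>) ^ n))"
    using tame_mono[OF assms(2), of "\<lambda>\<epsilon> p. \<bar>f \<epsilon> p\<bar>" 1] by (intro tame_intros) auto
  then show ?thesis
  proof (rule tame_mono[where D = 1])
    show "\<forall>\<^sub>F \<epsilon> in at_right 0. \<forall>p. \<bar>r \<epsilon> p\<bar> \<le> 1 * \<bar>\<bar>C\<bar> * (1 + \<bar>f \<epsilon> p\<bar>) ^ n\<bar>"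
      using assms(3)
    proof eventually_elim
      case (elim \<epsilon>)
      show ?case
      proof
        fix p
        obtain t where t: "r \<epsilon> p = \<phi> t" "\<bar>t\<bar> \<le> \<bar>f \<epsilon> p\<bar>" using elim by blast
        have "\<bar>\<phi> t\<bar> \<le> C * (1 + \<bar>t\<bar>) ^ n" by (rule assms(1))
        also have "\<dots> \<le> \<bar>C\<bar> * (1 + \<bar>f \<epsilon> p\<bar>) ^ n"
          using t(2) by (intro mult_mono power_mono) auto
        finally show "\<bar>r \<epsilon> p\<bar> \<le> 1 * \<bar>\<bar>C\<bar> * (1 + \<bar>f \<epsilon> p\<bar>) ^ n\<bar>" using t(1) by simp
      qed
    qed
  qed
qed

text \<open>
  This is \<open>f = a\<^sub>0 + a\<^sub>1 \<epsilon> + \<dots> + a\<^sub>n\<^sub>-\<^sub>1 \<epsilon>\<^sup>n\<^sup>-\<^sup>1 + \<epsilon>\<^sup>n r\<close> with tame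
  coefficients and a tame \<open>r\<close>; the length of the list is the order of the error. Dividing by \<open>\<epsilon>\<close>
  one step at a time lets the rules below be proved by induction on the list, without double sums.
\<close>

primrec jet :: "(real \<Rightarrow> real \<times> real \<Rightarrow> real) \<Rightarrow> (real \<times> real \<Rightarrow> real) list \<Rightarrow> bool" where
  "jet f [] \<longleftrightarrow> tame f"
| "jet f (a # as) \<longleftrightarrow> tame (\<lambda>_. a) \<and> jet (\<lambda>\<epsilon> p. (f \<epsilon> p - a p) / \<epsilon>) as"

lemma jet_cong: "\<forall>\<^sub>F \<epsilon> in at_right 0. f \<epsilon> = h \<epsilon> \<Longrightarrow> jet f as \<Longrightarrow> jet h as"
proof (induction as arbitrary: f h)
  case Nil
  then show ?case using tame_cong by auto
next
  case (Cons a as)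
  from Cons.prems(1) have "\<forall>\<^sub>F \<epsilon> in at_right 0. (\<lambda>p. (f \<epsilon> p - a p) / \<epsilon>) = (\<lambda>p. (h \<epsilon> p - a p) / \<epsilon>)"
    by eventually_elim simp
  with Cons show ?case by auto
qed

text \<open>
  The same notion without division: the quotient \<open>f'\<close> satisfies a polynomial identity, so jets
  can be manipulated by ring algebra.
\<close>

lemma jet_Cons_iff:
  "jet f (a # as) \<longleftrightarrow>
     tame (\<lambda>_. a) \<and> (\<exists>f'. jet f' as \<and> (\<forall>\<^sub>F \<epsilon> in at_right 0. \<forall>p. f \<epsilon> p = a p + \<epsilon> * f' \<epsilon> p))"
proof safe
  assume j: "jet f (a # as)"
  then show "tame (\<lambda>_. a)" by simp
  have "\<forall>\<^sub>F \<epsilon> in at_right 0. \<forall>p. f \<epsilon> p = a p + \<epsilon> * ((f \<epsilon> p - a p) / \<epsilon>)"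
    using eventually_at_right_0_small[of 1, simplified] by eventually_elim simp
  with j show "\<exists>f'. jet f' as \<and> (\<forall>\<^sub>F \<epsilon> in at_right 0. \<forall>p. f \<epsilon> p = a p + \<epsilon> * f' \<epsilon> p)"
    by auto
next
  fix f'
  assume t: "tame (\<lambda>_. a)" and j: "jet f' as" and e: "\<forall>\<^sub>F \<epsilon> in at_right 0. \<forall>p. f \<epsilon> p = a p + \<epsilon> * f' \<epsilon> p"
  have "\<forall>\<^sub>F \<epsilon> in at_right 0. f' \<epsilon> = (\<lambda>p. (f \<epsilon> p - a p) / \<epsilon>)"
    using e eventually_at_right_0_small[of 1, simplified] by eventually_elim (auto simp: fun_eq_iff)
  from jet_cong[OF this j] t show "jet f (a # as)" by simp
qed

lemma jet_tame: "jet f as \<Longrightarrow> tame f"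
proof (induction as arbitrary: f)
  case (Cons a as)
  then obtain f' where f': "jet f' as" "\<forall>\<^sub>F \<epsilon> in at_right 0. \<forall>p. f \<epsilon> p = a p + \<epsilon> * f' \<epsilon> p"
    and "tame (\<lambda>_. a)" unfolding jet_Cons_iff by blast
  then have "tame (\<lambda>\<epsilon> p. a p + \<epsilon> * f' \<epsilon> p)" using Cons.IH by (intro tame_intros) auto
  then show ?case by (rule tame_cong[rotated]) (use f'(2) in \<open>auto elim!: eventually_mono\<close>)
qed simp

fun jet_add :: "('a \<Rightarrow> real) list \<Rightarrow> ('a \<Rightarrow> real) list \<Rightarrow> ('a \<Rightarrow> real) list" where
  "jet_add (a # as) (b # bs) = (\<lambda>p. a p + b p) # jet_add as bs"
| "jet_add _ _ = []"

text \<open>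
  Truncated Cauchy product. The result has the length of the shorter argument, since the larger of
  the two errors prevails.
\<close>

fun jet_mult :: "('a \<Rightarrow> real) list \<Rightarrow> ('a \<Rightarrow> real) list \<Rightarrow> ('a \<Rightarrow> real) list" where
  "jet_mult (a # as) (b # bs) =
     (\<lambda>p. a p * b p) # jet_add (jet_mult as (b # bs)) (map (\<lambda>c p. a p * c p) bs)"
| "jet_mult _ _ = []"

lemma jet_add: "jet f as \<Longrightarrow> jet h bs \<Longrightarrow> jet (\<lambda>\<epsilon> p. f \<epsilon> p + h \<epsilon> p) (jet_add as bs)"
proof (induction as bs arbitrary: f h rule: jet_add.induct)
  case (1 a as b bs)
  obtain f' where f': "jet f' as" "\<forall>\<^sub>F \<epsilon> in at_right 0. \<forall>p. f \<epsilon> p = a p + \<epsilon> * f' \<epsilon> p"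
    and a: "tame (\<lambda>_. a)" using 1(2) unfolding jet_Cons_iff by blast
  obtain h' where h': "jet h' bs" "\<forall>\<^sub>F \<epsilon> in at_right 0. \<forall>p. h \<epsilon> p = b p + \<epsilon> * h' \<epsilon> p"
    and b: "tame (\<lambda>_. b)" using 1(3) unfolding jet_Cons_iff by blast
  have "\<forall>\<^sub>F \<epsilon> in at_right 0. \<forall>p. f \<epsilon> p + h \<epsilon> p = (a p + b p) + \<epsilon> * (f' \<epsilon> p + h' \<epsilon> p)"
    using f'(2) h'(2) by eventually_elim (simp add: algebra_simps)
  with 1(1)[OF f'(1) h'(1)] tame_add[OF a b] show ?case
    by (auto simp del: jet.simps simp: jet_Cons_iff)
next
  case ("2_1" bs)
  then show ?case by (simp add: tame_add jet_tame)
next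
  case ("2_2" as)
  then show ?case using jet_tame by (simp add: tame_add)
qed

lemma jet_smult: "tame (\<lambda>_. a) \<Longrightarrow> jet f as \<Longrightarrow> jet (\<lambda>\<epsilon> p. a p * f \<epsilon> p) (map (\<lambda>c p. a p * c p) as)"
proof (induction as arbitrary: f)
  case Nil
  then show ?case by (simp add: tame_mult)
next
  case (Cons b as)
  have "(\<lambda>\<epsilon> p. (a p * f \<epsilon> p - a p * b p) / \<epsilon>) = (\<lambda>\<epsilon> p. a p * ((f \<epsilon> p - b p) / \<epsilon>))"
    by (simp add: algebra_simps)
  moreover have "jet (\<lambda>\<epsilon> p. a p * ((f \<epsilon> p - b p) / \<epsilon>)) (map (\<lambda>c p. a p * c p) as)"
    using Cons.prems by (intro Cons.IH) (simp_all only: jet.simps)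
  moreover have "tame (\<lambda>_ p. a p * b p)"
    using Cons.prems by (intro tame_mult) simp_all
  ultimately show ?case by (simp only: jet.simps list.map)
qed

text \<open>
  If \<open>f = a + \<epsilon> f'\<close> and \<open>h = b + \<epsilon> h'\<close>, then \<open>f h = a b + \<epsilon> (f' h + a h')\<close>, and the
  induction hypothesis applies to \<open>f' h\<close>.
\<close>

lemma jet_mult: "jet f as \<Longrightarrow> jet h bs \<Longrightarrow> jet (\<lambda>\<epsilon> p. f \<epsilon> p * h \<epsilon> p) (jet_mult as bs)"
proof (induction as arbitrary: f)
  case Nil
  then show ?case by (simp add: tame_mult jet_tame)
next
  case (Cons a as)
  show ?case
  proof (cases bs)
    case Nil
    then show ?thesis using Cons.prems jet_tame[OF Cons.prems(1)] by (simp add: tame_mult)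
  next
    case (Cons b bs')
    obtain f' where f': "jet f' as" "\<forall>\<^sub>F \<epsilon> in at_right 0. \<forall>p. f \<epsilon> p = a p + \<epsilon> * f' \<epsilon> p"
      and a: "tame (\<lambda>_. a)" using Cons.prems(1) unfolding jet_Cons_iff by blast
    obtain h' where h': "jet h' bs'" "\<forall>\<^sub>F \<epsilon> in at_right 0. \<forall>p. h \<epsilon> p = b p + \<epsilon> * h' \<epsilon> p"
      and b: "tame (\<lambda>_. b)" using Cons.prems(2) unfolding Cons jet_Cons_iff by blast
    have "\<forall>\<^sub>F \<epsilon> in at_right 0. \<forall>p. f \<epsilon> p * h \<epsilon> p = a p * b p + \<epsilon> * (f' \<epsilon> p * h \<epsilon> p + a p * h' \<epsilon> p)"
      using f'(2) h'(2) by eventually_elim (simp add: algebra_simps)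
    moreover have "jet (\<lambda>\<epsilon> p. f' \<epsilon> p * h \<epsilon> p + a p * h' \<epsilon> p)
        (jet_add (jet_mult as (b # bs')) (map (\<lambda>c p. a p * c p) bs'))"
      using Cons.IH[OF f'(1) Cons.prems(2)] jet_smult[OF a h'(1)] Cons by (intro jet_add) auto
    ultimately show ?thesis
      using tame_mult[OF a b] unfolding Cons jet_mult.simps jet_Cons_iff by blast
  qed
qed

lemma jet_eps: "jet f as \<Longrightarrow> jet (\<lambda>\<epsilon> p. \<epsilon> * f \<epsilon> p) ((\<lambda>_. 0) # as)"
  unfolding jet_Cons_iff by auto

lemma jet_eps_power: "jet f as \<Longrightarrow> jet (\<lambda>\<epsilon> p. \<epsilon> ^ k * f \<epsilon> p) (replicate k (\<lambda>_. 0) @ as)"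
proof (induction k)
  case (Suc k)
  have "(\<lambda>\<epsilon> p. \<epsilon> ^ Suc k * f \<epsilon> p) = (\<lambda>\<epsilon> p. \<epsilon> * (\<epsilon> ^ k * f \<epsilon> p))" by (simp add: mult_ac)
  with jet_eps[OF Suc.IH[OF Suc.prems]] show ?case by simp
qed simp

lemma jet_zero: "jet (\<lambda>_ _. 0) (replicate n (\<lambda>_. 0))"
  by (induction n) simp_all

lemma jet_indep: "tame (\<lambda>_. a) \<Longrightarrow> jet (\<lambda>_. a) (a # replicate n (\<lambda>_. 0))"
  using jet_zero[of n] by simp

lemma jet_Horner: "tame (\<lambda>_. a) \<Longrightarrow> jet f as \<Longrightarrow> jet (\<lambda>\<epsilon> p. a p + \<epsilon> * f \<epsilon> p) (a # as)"
  unfolding jet_Cons_iff by auto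

lemma jet_take: "jet f as \<Longrightarrow> jet f (take n as)"
proof (induction as arbitrary: f n)
  case (Cons a as)
  show ?case
  proof (cases n)
    case 0
    then show ?thesis using jet_tame[OF Cons.prems] by simp
  next
    case (Suc k)
    then show ?thesis using Cons by simp
  qed
qed simp

text \<open>
  Comparison of coefficients: the lists produced by the rules above are replaced by simplified ones.
\<close>

lemma jet_rewrite:
  assumes "jet f as" "\<And>\<epsilon> p. f \<epsilon> p = h \<epsilon> p" "list_all2 (\<lambda>a b. \<forall>x z. a (x, z) = b (x, z)) as bs"
  shows "jet h bs"
proof -
  have "as = bs"
    using assms(3) by (induction rule: list_all2_induct) (auto simp: fun_eq_iff)
  moreover have "f = h" using assms(2) by (simp add: fun_eq_iff)
  ultimately show ?thesis using assms(1) by simp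
qed

text \<open>
  At an argument of order \<open>\<epsilon>\<^sup>2\<close> a quadratic approximation of \<open>\<phi>\<close> has an error of order \<open>\<epsilon>\<^sup>6\<close>. This
  reduces logarithms and reciprocals of the scale to polynomials.
\<close>

lemma jet_second_order:
  assumes "\<And>s. \<bar>s\<bar> \<le> 1 / 2 \<Longrightarrow> \<bar>\<phi> s - (c0 + c1 * s + c2 * s^2)\<bar> \<le> C * \<bar>s\<bar>^3" and "tame \<tau>"
    and "\<forall>\<^sub>F \<epsilon> in at_right 0. \<forall>p. \<bar>\<epsilon>^2 * \<tau> \<epsilon> p\<bar> \<le> 1 / 2"
  shows "jet (\<lambda>\<epsilon> p. \<phi> (\<epsilon>^2 * \<tau> \<epsilon> p) - (c0 + c1 * (\<epsilon>^2 * \<tau> \<epsilon> p) + c2 * (\<epsilon>^2 * \<tau> \<epsilon> p)^2))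
           (replicate 6 (\<lambda>_. 0))"
proof -
  let ?r = "\<lambda>\<epsilon> p. (\<phi> (\<epsilon>^2 * \<tau> \<epsilon> p) - (c0 + c1 * (\<epsilon>^2 * \<tau> \<epsilon> p) + c2 * (\<epsilon>^2 * \<tau> \<epsilon> p)^2)) / \<epsilon>^6"
  have pos: "\<forall>\<^sub>F \<epsilon> in at_right 0. 0 < (\<epsilon>::real)"
    using eventually_at_right_0_small[of 1, simplified] by (auto elim: eventually_mono)
  have "tame ?r"
  proof (rule tame_mono[where D = C])
    show "tame (\<lambda>\<epsilon> p. \<tau> \<epsilon> p ^ 3)" using assms(2) by (rule tame_power)
    show "\<forall>\<^sub>F \<epsilon> in at_right 0. \<forall>p. \<bar>?r \<epsilon> p\<bar> \<le> C * \<bar>\<tau> \<epsilon> p ^ 3\<bar>"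
      using assms(3) pos
    proof eventually_elim
      case (elim \<epsilon>)
      show ?case
      proof
        fix p
        have "\<bar>\<phi> (\<epsilon>^2 * \<tau> \<epsilon> p) - (c0 + c1 * (\<epsilon>^2 * \<tau> \<epsilon> p) + c2 * (\<epsilon>^2 * \<tau> \<epsilon> p)^2)\<bar>
            \<le> C * \<bar>\<epsilon>^2 * \<tau> \<epsilon> p\<bar>^3"
          by (rule assms(1)) (use elim in blast)
        also have "\<dots> = C * \<bar>\<tau> \<epsilon> p ^ 3\<bar> * \<epsilon>^6"
          by (simp add: abs_mult power_mult_distrib power_abs flip: power_mult)
        finally show "\<bar>?r \<epsilon> p\<bar> \<le> C * \<bar>\<tau> \<epsilon> p ^ 3\<bar>"
          using elim(2) by (simp add: divide_le_eq)
      qed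
    qed
  qed
  from jet_eps_power[of _ "[]" 6, unfolded jet.simps append_Nil2, OF this]
  show ?thesis
  proof (rule jet_cong[rotated])
    show "\<forall>\<^sub>F \<epsilon> in at_right 0. (\<lambda>p. \<epsilon>^6 * ?r \<epsilon> p) =
       (\<lambda>p. \<phi> (\<epsilon>^2 * \<tau> \<epsilon> p) - (c0 + c1 * (\<epsilon>^2 * \<tau> \<epsilon> p) + c2 * (\<epsilon>^2 * \<tau> \<epsilon> p)^2))"
      using pos by eventually_elim simp
  qed
qed

lemma ln_1p_second_order:
  fixes s :: real
  assumes "\<bar>s\<bar> \<le> 1 / 2"
  shows "\<bar>ln (1 + s) - (0 + 1 * s + (- 1 / 2) * s^2)\<bar> \<le> 2 * \<bar>s\<bar>^3"
proof -
  let ?h = "\<lambda>s::real. ln (1 + s) - s + s^2 / 2"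
  have "norm (?h s - ?h 0) \<le> (2 * \<bar>s\<bar>^2) * norm (s - 0)"
  proof (rule field_differentiable_bound[where S = "cball 0 \<bar>s\<bar>" and f' = "\<lambda>t. t^2 / (1 + t)"])
    fix t :: real assume "t \<in> cball 0 \<bar>s\<bar>"
    then have t: "\<bar>t\<bar> \<le> \<bar>s\<bar>" by (simp add: dist_real_def)
    with assms have t': "1 / 2 \<le> 1 + t" by linarith
    then show "(?h has_field_derivative t^2 / (1 + t)) (at t within cball 0 \<bar>s\<bar>)"
      by (auto intro!: derivative_eq_intros simp: field_simps power2_eq_square)
    have "t^2 / (1 + t) \<le> \<bar>s\<bar>^2 / (1 / 2)"
      using t t' by (intro frac_le) (auto simp: abs_le_square_iff)
    then show "norm (t^2 / (1 + t)) \<le> 2 * \<bar>s\<bar>^2"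
      using t' by simp
  qed auto
  then show ?thesis by (simp add: power3_eq_cube power2_eq_square mult_ac)
qed

lemma inverse_1p_second_order:
  fixes s :: real
  assumes "\<bar>s\<bar> \<le> 1 / 2"
  shows "\<bar>1 / (1 + s) - (1 + (- 1) * s + 1 * s^2)\<bar> \<le> 2 * \<bar>s\<bar>^3"
proof -
  have s: "1 / 2 \<le> 1 + s" using assms by linarith
  then have "1 / (1 + s) - (1 + (- 1) * s + 1 * s^2) = - (s^3 / (1 + s))"
    by (simp add: field_simps power2_eq_square power3_eq_cube)
  moreover have "\<bar>s\<bar>^3 / (1 + s) \<le> \<bar>s\<bar>^3 / (1 / 2)"
    using s by (intro divide_left_mono) auto
  ultimately show ?thesis using s by (simp add: power_abs)
qed

section \<open>The log ratio of one coordinate to fifth order\<close>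

locale fmala_target =
  fixes g :: "real \<Rightarrow> real"
  assumes smooth: "Ck_real 10 g"
    and bounded_second_deriv: "bounded (range ((deriv ^^ 2) g))"
    and poly_growth: "\<exists>C \<kappa> :: real. \<forall>t. \<forall>i\<in>{1..10}. \<bar>(deriv ^^ i) g t\<bar> \<le> C * (1 + \<bar>t\<bar> powr \<kappa>)"
    and integrable_moments: "\<And>k :: nat. integrable lborel (\<lambda>t. t ^ k * exp (g t))"
begin

text \<open>
  A constant of its own, so that the simplifier does not unfold iterated derivatives.
\<close>

definition D :: "nat \<Rightarrow> real \<Rightarrow> real" where
  "D j = (deriv ^^ j) g"

lemma D_0: "D 0 = g" by (simp add: D_def)

lemma deriv_eq_D: "deriv g = D 1" "(deriv ^^ 2) g = D 2" "(deriv ^^ 3) g = D 3"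
  "(deriv ^^ 4) g = D 4" "(deriv ^^ 5) g = D 5"
  by (simp_all add: D_def)

lemma DERIV_D: "j < 10 \<Longrightarrow> (D j has_real_derivative D (Suc j) t) (at t)"
  using smooth by (auto simp: Ck_real_def D_def differentiable_on_def DERIV_deriv_iff_real_differentiable)

lemma continuous_on_D: "j \<le> 10 \<Longrightarrow> continuous_on UNIV (D j)"
proof (cases "j = 10")
  case True
  with smooth show ?thesis by (simp add: Ck_real_def D_def)
next
  case False
  assume "j \<le> 10"
  with False have "j < 10" by simp
  then show ?thesis
    using DERIV_isCont[OF DERIV_D] by (auto intro!: continuous_at_imp_continuous_on)
qed

lemma measurable_D [measurable]: "j \<le> 10 \<Longrightarrow> D j \<in> borel_measurable borel"
  by (intro borel_measurable_continuous_onI continuous_on_D)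

text \<open>
  The exponent \<open>\<kappa>\<close> may be negative or fractional. Outside \<open>[-1, 1]\<close> it may be replaced by a natural
  number \<open>n \<ge> \<bar>\<kappa>\<bar>\<close>, and on \<open>[-1, 1]\<close> the derivative is bounded by continuity.
\<close>

lemma D_poly_growth:
  assumes "1 \<le> j" "j \<le> 10"
  shows "\<exists>C n. \<forall>t. \<bar>D j t\<bar> \<le> C * (1 + \<bar>t\<bar>) ^ n"
proof -
  obtain C \<kappa> :: real where C: "\<And>t. \<bar>D j t\<bar> \<le> C * (1 + \<bar>t\<bar> powr \<kappa>)"
    using poly_growth assms unfolding D_def by (meson atLeastAtMost_iff)
  define n where "n = nat \<lceil>\<bar>\<kappa>\<bar>\<rceil>"
  have "compact (D j ` {-1..1})"
    by (intro compact_continuous_image continuous_on_subset[OF continuous_on_D]) (use assms in auto)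
  then obtain B where B: "\<And>t. t \<in> {-1..1} \<Longrightarrow> \<bar>D j t\<bar> \<le> B"
    by (force dest!: compact_imp_bounded simp: bounded_iff)
  have B0: "0 \<le> B" using B[of 0] by simp
  have "\<bar>D j t\<bar> \<le> (B + 2 * \<bar>C\<bar>) * (1 + \<bar>t\<bar>) ^ n" for t
  proof (cases "\<bar>t\<bar> \<le> 1")
    case True
    then have "\<bar>D j t\<bar> \<le> B * 1" using B[of t] by (simp add: abs_le_iff)
    also have "\<dots> \<le> (B + 2 * \<bar>C\<bar>) * (1 + \<bar>t\<bar>) ^ n"
      using B0 by (intro mult_mono) auto
    finally show ?thesis .
  next
    case False
    have "\<bar>t\<bar> powr \<kappa> \<le> \<bar>t\<bar> powr real n"
      using False by (intro powr_mono) (auto simp: n_def, linarith)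
    also have "\<dots> \<le> (1 + \<bar>t\<bar>) ^ n"
      using False by (simp add: powr_realpow power_mono)
    finally have "1 + \<bar>t\<bar> powr \<kappa> \<le> 2 * (1 + \<bar>t\<bar>) ^ n"
      using one_le_power[of "1 + \<bar>t\<bar>" n] by linarith
    then have "\<bar>C\<bar> * (1 + \<bar>t\<bar> powr \<kappa>) \<le> \<bar>C\<bar> * (2 * (1 + \<bar>t\<bar>) ^ n)"
      by (intro mult_left_mono) auto
    moreover have "C * (1 + \<bar>t\<bar> powr \<kappa>) \<le> \<bar>C\<bar> * (1 + \<bar>t\<bar> powr \<kappa>)"
      by (intro mult_right_mono) (auto intro: add_nonneg_nonneg)
    moreover have "0 \<le> B * (1 + \<bar>t\<bar>) ^ n"
      using B0 by simp
    ultimately show ?thesis using C[of t] by (simp add: algebra_simps)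
  qed
  then show ?thesis by blast
qed

lemma tame_D:
  assumes "1 \<le> j" "j \<le> 10" "tame f"
  shows "tame (\<lambda>\<epsilon> p. D j (f \<epsilon> p))"
proof -
  obtain C n where "\<And>t. \<bar>D j t\<bar> \<le> C * (1 + \<bar>t\<bar>) ^ n"
    using D_poly_growth assms by blast
  then show ?thesis
    by (rule tame_compose_poly_growth[OF _ assms(3)]) (rule always_eventually, blast)
qed

text \<open>
  In Lagrange form the remainder is \<open>\<epsilon>\<^sup>m v\<^sup>m D\<^sub>j\<^sub>+\<^sub>m(\<zeta>) / m!\<close> with \<open>\<bar>\<zeta>\<bar> \<le> \<bar>x\<bar> + \<bar>\<epsilon> v\<bar>\<close>, and the
  cofactor of \<open>\<epsilon>\<^sup>m\<close> is tame by the polynomial growth of the derivative.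
\<close>

lemma jet_Taylor_remainder:
  assumes "1 \<le> j + m" "j + m \<le> 10" "tame v"
  shows "jet (\<lambda>\<epsilon> p. D j (fst p + \<epsilon> * v \<epsilon> p) - (\<Sum>i<m. D (j + i) (fst p) / fact i * (\<epsilon> * v \<epsilon> p) ^ i))
           (replicate m (\<lambda>_. 0))"
proof -
  let ?w = "\<lambda>\<epsilon> p. \<epsilon> * v \<epsilon> p"
  have ex: "\<exists>t. \<bar>t\<bar> \<le> \<bar>x\<bar> + \<bar>w\<bar> \<and>
      D j (x + w) = (\<Sum>i<m. D (j + i) x / fact i * w ^ i) + D (j + m) t / fact m * w ^ m" for x w
  proof (cases "m = 0 \<or> w = 0")
    case True
    then show ?thesis
    proof (elim disjE)
      assume "m = 0"
      then show ?thesis by (intro exI[of _ "x + w"]) auto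
    next
      assume "w = 0"
      then show ?thesis
        by (cases m) (auto intro!: exI[of _ x] simp: sum.lessThan_Suc_shift simp del: sum.lessThan_Suc)
    qed
  next
    case False
    define a b where "a = min x (x + w)" and "b = max x (x + w)"
    have "\<exists>t. (if x + w < x then x + w < t \<and> t < x else x < t \<and> t < x + w) \<and>
        D j (x + w) = (\<Sum>i<m. D (j + i) x / fact i * (x + w - x) ^ i) + D (j + m) t / fact m * (x + w - x) ^ m"
      by (rule Taylor[where a = a and b = b]) (use False assms in \<open>auto simp: a_def b_def intro!: DERIV_D\<close>)
    then obtain t where t: "if x + w < x then x + w < t \<and> t < x else x < t \<and> t < x + w"
      "D j (x + w) = (\<Sum>i<m. D (j + i) x / fact i * w ^ i) + D (j + m) t / fact m * w ^ m"
      by auto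
    then show ?thesis by (intro exI[of _ t]) (auto split: if_splits)
  qed
  obtain \<zeta> where \<zeta>: "\<And>x w. \<bar>\<zeta> x w\<bar> \<le> \<bar>x\<bar> + \<bar>w\<bar>"
    "\<And>x w. D j (x + w) = (\<Sum>i<m. D (j + i) x / fact i * w ^ i) + D (j + m) (\<zeta> x w) / fact m * w ^ m"
  proof
    define \<zeta> where "\<zeta> x w = (SOME t. \<bar>t\<bar> \<le> \<bar>x\<bar> + \<bar>w\<bar> \<and>
      D j (x + w) = (\<Sum>i<m. D (j + i) x / fact i * w ^ i) + D (j + m) t / fact m * w ^ m)" for x w
    show "\<bar>\<zeta> x w\<bar> \<le> \<bar>x\<bar> + \<bar>w\<bar>" for x w
      using someI_ex[OF ex[of x w]] unfolding \<zeta>_def by (rule conjunct1)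
    show "D j (x + w) = (\<Sum>i<m. D (j + i) x / fact i * w ^ i) + D (j + m) (\<zeta> x w) / fact m * w ^ m" for x w
      using someI_ex[OF ex[of x w]] unfolding \<zeta>_def by (rule conjunct2)
  qed
  have "tame (\<lambda>\<epsilon> p. \<bar>fst p\<bar> + \<bar>?w \<epsilon> p\<bar>)"
    using tame_mono[OF tame_fst, of "\<lambda>\<epsilon> p. \<bar>fst p\<bar>" 1]
      tame_mono[OF tame_mult[OF tame_eps assms(3)], of "\<lambda>\<epsilon> p. \<bar>?w \<epsilon> p\<bar>" 1]
    by (intro tame_intros) auto
  then have "tame (\<lambda>\<epsilon> p. \<zeta> (fst p) (?w \<epsilon> p))"
    by (rule tame_mono[where D = 1]) (intro always_eventually allI order_trans[OF \<zeta>(1)], simp)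
  then have "tame (\<lambda>\<epsilon> p. D (j + m) (\<zeta> (fst p) (?w \<epsilon> p)) / fact m * v \<epsilon> p ^ m)"
    using assms by (intro tame_intros tame_D) auto
  from jet_eps_power[of _ "[]" m, unfolded jet.simps append_Nil2, OF this]
  show ?thesis
    by (rule jet_cong[rotated]) (simp add: \<zeta>(2) power_mult_distrib mult_ac)
qed

text \<open>
  The displacement \<open>y - x\<close> of the proposal, divided by \<open>\<epsilon>\<close>.
\<close>

definition scaled_incr :: "real \<Rightarrow> real \<times> real \<Rightarrow> real" where
  "scaled_incr \<epsilon> = (\<lambda>(x, z). z + \<epsilon> * (D 1 x / 2) + \<epsilon>^2 * (z * D 2 x / 12) - \<epsilon>^3 * ((D 2 x * D 1 x + D 3 x) / 24))"

definition proposed :: "real \<Rightarrow> real \<times> real \<Rightarrow> real" where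
  "proposed \<epsilon> p = fst p + \<epsilon> * scaled_incr \<epsilon> p"

lemma tame_D_fst [simp]: "1 \<le> j \<Longrightarrow> j \<le> 10 \<Longrightarrow> tame (\<lambda>\<epsilon> p. D j (fst p))"
  by (rule tame_D) auto

lemma jet_scaled_incr: "jet scaled_incr
     [\<lambda>(x, z). z,
      \<lambda>(x, z). D 1 x / 2,
      \<lambda>(x, z). z * D 2 x / 12,
      \<lambda>(x, z). - (D 1 x * D 2 x / 24) - D 3 x / 24,
      \<lambda>_. 0,
      \<lambda>_. 0]"
proof -
  have *: "scaled_incr = (\<lambda>\<epsilon> p. (case p of (x, z) \<Rightarrow> z) + \<epsilon> * ((case p of (x, z) \<Rightarrow> D 1 x / 2) + \<epsilon> * ((case p of (x, z) \<Rightarrow> z * D 2 x / 12)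
     + \<epsilon> * ((case p of (x, z) \<Rightarrow> - (D 1 x * D 2 x / 24) - D 3 x / 24) + \<epsilon> * (0 + \<epsilon> * (0 + \<epsilon> * 0))))))"
    by (simp add: scaled_incr_def fun_eq_iff field_simps power2_eq_square power3_eq_cube)
  show ?thesis
    unfolding * by (intro jet_Horner) (simp_all add: case_prod_beta tame_intros)
qed

text \<open>
  Powers of the displacement to order six, as they enter the Taylor polynomials of \<open>g\<close> and its
  derivatives at the proposed point.
\<close>

lemma jet_incr_power0: "jet (\<lambda>\<epsilon> p. (\<epsilon> * scaled_incr \<epsilon> p) ^ 0)
     [\<lambda>_. 1,
      \<lambda>_. 0,
      \<lambda>_. 0,
      \<lambda>_. 0,
      \<lambda>_. 0,
      \<lambda>_. 0]"
  using jet_indep[of "\<lambda>_. 1" 5] by (simp add: eval_nat_numeral)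

lemma jet_incr_power1: "jet (\<lambda>\<epsilon> p. \<epsilon> * scaled_incr \<epsilon> p)
     [\<lambda>_. 0,
      \<lambda>(x, z). z,
      \<lambda>(x, z). D 1 x / 2,
      \<lambda>(x, z). z * D 2 x / 12,
      \<lambda>(x, z). - (D 1 x * D 2 x / 24) - D 3 x / 24,
      \<lambda>_. 0]"
  by (rule jet_rewrite[OF jet_take[OF jet_eps[OF jet_scaled_incr], of 6]]) simp_all

lemma jet_incr_power2: "jet (\<lambda>\<epsilon> p. (\<epsilon> * scaled_incr \<epsilon> p)^2)
     [\<lambda>_. 0,
      \<lambda>_. 0,
      \<lambda>(x, z). z^2,
      \<lambda>(x, z). z * D 1 x,
      \<lambda>(x, z). z^2 * D 2 x / 6 + D 1 x^2 / 4,
      \<lambda>(x, z). - (z * D 3 x / 12)]"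
  by (rule jet_rewrite[OF jet_mult[OF jet_incr_power1 jet_incr_power1]])
    (simp_all add: field_simps power2_eq_square)

lemma jet_incr_power3: "jet (\<lambda>\<epsilon> p. (\<epsilon> * scaled_incr \<epsilon> p)^3)
     [\<lambda>_. 0,
      \<lambda>_. 0,
      \<lambda>_. 0,
      \<lambda>(x, z). z^3,
      \<lambda>(x, z). 3 * z^2 * D 1 x / 2,
      \<lambda>(x, z). z^3 * D 2 x / 4 + 3 * z * D 1 x^2 / 4]"
  by (rule jet_rewrite[OF jet_mult[OF jet_incr_power2 jet_incr_power1]])
    (simp_all add: field_simps eval_nat_numeral)

lemma jet_incr_power4: "jet (\<lambda>\<epsilon> p. (\<epsilon> * scaled_incr \<epsilon> p)^4)
     [\<lambda>_. 0,
      \<lambda>_. 0,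
      \<lambda>_. 0,
      \<lambda>_. 0,
      \<lambda>(x, z). z^4,
      \<lambda>(x, z). 2 * z^3 * D 1 x]"
  by (rule jet_rewrite[OF jet_mult[OF jet_incr_power2 jet_incr_power2]])
    (simp_all add: field_simps eval_nat_numeral)

lemma jet_incr_power5: "jet (\<lambda>\<epsilon> p. (\<epsilon> * scaled_incr \<epsilon> p)^5)
     [\<lambda>_. 0,
      \<lambda>_. 0,
      \<lambda>_. 0,
      \<lambda>_. 0,
      \<lambda>_. 0,
      \<lambda>(x, z). z^5]"
  by (rule jet_rewrite[OF jet_mult[OF jet_incr_power2 jet_incr_power3]])
    (simp_all add: field_simps eval_nat_numeral)

text \<open>
  In the log ratio the first, second and third derivative of \<open>g\<close> at the proposed point carry the
  factors \<open>\<epsilon>\<close>, \<open>\<epsilon>\<^sup>2\<close> and \<open>\<epsilon>\<^sup>3\<close>, so five, four and three of their coefficients suffice for an error of order six.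
\<close>

lemma jet_D1: "jet (\<lambda>\<epsilon> p. D 1 (proposed \<epsilon> p))
     [\<lambda>(x, z). D 1 x,
      \<lambda>(x, z). z * D 2 x,
      \<lambda>(x, z). z^2 * D 3 x / 2 + D 1 x * D 2 x / 2,
      \<lambda>(x, z). z^3 * D 4 x / 6 + z * D 1 x * D 3 x / 2 + z * D 2 x^2 / 12,
      \<lambda>(x, z). z^4 * D 5 x / 24 + z^2 * D 1 x * D 4 x / 4 + z^2 * D 2 x * D 3 x / 12 + D 1 x^2 * D 3 x / 8 - D 1 x * D 2 x^2 / 24 - D 2 x * D 3 x / 24]"
  by (rule jet_rewrite[OF jet_add[OF jet_Taylor_remainder[of 1 5, OF _ _ jet_tame[OF jet_scaled_incr]]
        jet_add[OF jet_smult[OF tame_D_fst[of 1] jet_incr_power0]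
        jet_add[OF jet_smult[OF tame_D_fst[of 2] jet_incr_power1]
        jet_add[OF jet_smult[OF tame_divide[OF tame_D_fst[of 3], of 2] jet_incr_power2]
        jet_add[OF jet_smult[OF tame_divide[OF tame_D_fst[of 4], of 6] jet_incr_power3]
                   jet_smult[OF tame_divide[OF tame_D_fst[of 5], of 24] jet_incr_power4]]]]]]])
   (simp_all add: proposed_def eval_nat_numeral, (simp_all add: field_simps)?)

lemma jet_D0_diff: "jet (\<lambda>\<epsilon> p. g (proposed \<epsilon> p) - g (fst p))
     [\<lambda>_. 0,
      \<lambda>(x, z). z * D 1 x,
      \<lambda>(x, z). z^2 * D 2 x / 2 + D 1 x^2 / 2,
      \<lambda>(x, z). z^3 * D 3 x / 6 + 7 * z * D 1 x * D 2 x / 12,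
      \<lambda>(x, z). z^4 * D 4 x / 24 + z^2 * D 1 x * D 3 x / 4 + z^2 * D 2 x^2 / 12 + D 1 x^2 * D 2 x / 12 - D 1 x * D 3 x / 24,
      \<lambda>(x, z). z^5 * D 5 x / 120 + z^3 * D 1 x * D 4 x / 12 + z^3 * D 2 x * D 3 x / 24 + z * D 1 x^2 * D 3 x / 8 - z * D 2 x * D 3 x / 24]"
  by (rule jet_rewrite[OF jet_add[OF jet_Taylor_remainder[of 0 6, OF _ _ jet_tame[OF jet_scaled_incr]]
        jet_add[OF jet_smult[OF tame_D_fst[of 1] jet_incr_power1]
        jet_add[OF jet_smult[OF tame_divide[OF tame_D_fst[of 2], of 2] jet_incr_power2]
        jet_add[OF jet_smult[OF tame_divide[OF tame_D_fst[of 3], of 6] jet_incr_power3]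
        jet_add[OF jet_smult[OF tame_divide[OF tame_D_fst[of 4], of 24] jet_incr_power4]
                   jet_smult[OF tame_divide[OF tame_D_fst[of 5], of 120] jet_incr_power5]]]]]]])
   (simp_all add: proposed_def D_0 eval_nat_numeral, (simp_all add: field_simps)?)

lemma jet_D2: "jet (\<lambda>\<epsilon> p. D 2 (proposed \<epsilon> p))
     [\<lambda>(x, z). D 2 x,
      \<lambda>(x, z). z * D 3 x,
      \<lambda>(x, z). z^2 * D 4 x / 2 + D 1 x * D 3 x / 2,
      \<lambda>(x, z). z^3 * D 5 x / 6 + z * D 1 x * D 4 x / 2 + z * D 2 x * D 3 x / 12]"
  by (rule jet_rewrite[OF jet_add[OF jet_Taylor_remainder[of 2 4, OF _ _ jet_tame[OF jet_scaled_incr]]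
        jet_add[OF jet_smult[OF tame_D_fst[of 2] jet_incr_power0]
        jet_add[OF jet_smult[OF tame_D_fst[of 3] jet_incr_power1]
        jet_add[OF jet_smult[OF tame_divide[OF tame_D_fst[of 4], of 2] jet_incr_power2]
                   jet_smult[OF tame_divide[OF tame_D_fst[of 5], of 6] jet_incr_power3]]]]]])
   (simp_all add: proposed_def eval_nat_numeral, (simp_all add: field_simps)?)

lemma jet_D3: "jet (\<lambda>\<epsilon> p. D 3 (proposed \<epsilon> p))
     [\<lambda>(x, z). D 3 x,
      \<lambda>(x, z). z * D 4 x,
      \<lambda>(x, z). z^2 * D 5 x / 2 + D 1 x * D 4 x / 2]"
  by (rule jet_rewrite[OF jet_add[OF jet_Taylor_remainder[of 3 3, OF _ _ jet_tame[OF jet_scaled_incr]]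
        jet_add[OF jet_smult[OF tame_D_fst[of 3] jet_incr_power0]
        jet_add[OF jet_smult[OF tame_D_fst[of 4] jet_incr_power1]
                   jet_smult[OF tame_divide[OF tame_D_fst[of 5], of 2] jet_incr_power2]]]]])
   (simp_all add: proposed_def eval_nat_numeral, (simp_all add: field_simps)?)

text \<open>
  The scale of the proposal noise divided by its leading term \<open>\<epsilon>\<close>.
\<close>

definition rel_scale :: "real \<Rightarrow> real \<Rightarrow> real" where
  "rel_scale \<epsilon> t = 1 + \<epsilon>^2 * (D 2 t / 12)"

text \<open>
  Boundedness of \<open>g''\<close> makes the threshold on \<open>\<epsilon>\<close> uniform in the point. It keeps \<open>rel_scale\<close> in
  \<open>[1/2, 3/2]\<close>.
\<close>

lemma eventually_small_curvature: "\<forall>\<^sub>F \<epsilon> in at_right 0. \<forall>t. \<bar>\<epsilon>^2 * (D 2 t / 12)\<bar> \<le> 1 / 2"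
proof -
  obtain M where M: "\<And>t. \<bar>D 2 t\<bar> \<le> M"
    using bounded_second_deriv by (auto simp: bounded_iff D_def)
  have "0 \<le> M" using M[of 0] by simp
  \<comment> \<open>\<open>\<epsilon> < 1\<close> and \<open>\<epsilon> (M + 1) < 6\<close> together give \<open>\<epsilon>\<^sup>2 M \<le> 6\<close>\<close>
  then have "\<forall>\<^sub>F \<epsilon> in at_right 0. 0 < \<epsilon> \<and> \<epsilon> < min 1 (6 / (M + 1))"
    by (intro eventually_at_right_0_small) auto
  then show ?thesis
  proof eventually_elim
    case (elim \<epsilon>)
    have "\<epsilon>^2 * M \<le> \<epsilon> * (M + 1)"
      using elim \<open>0 \<le> M\<close> by (intro mult_mono) (auto simp: power2_eq_square mult_le_cancel_left1)
    also have "\<dots> \<le> 6"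
      using elim \<open>0 \<le> M\<close> by (simp add: field_simps)
    finally have *: "\<epsilon>^2 * M \<le> 6" .
    have "\<epsilon>^2 * \<bar>D 2 t\<bar> \<le> 6" for t
      using mult_left_mono[OF M, of "\<epsilon>^2" t] * by simp
    then show ?case by (simp add: abs_mult)
  qed
qed

lemma jet_scale_excess: "jet (\<lambda>\<epsilon> p. \<epsilon>^2 * (D 2 (proposed \<epsilon> p) / 12))
     [\<lambda>_. 0,
      \<lambda>_. 0,
      \<lambda>(x, z). D 2 x / 12,
      \<lambda>(x, z). z * D 3 x / 12,
      \<lambda>(x, z). z^2 * D 4 x / 24 + D 1 x * D 3 x / 24,
      \<lambda>(x, z). z^3 * D 5 x / 72 + z * D 1 x * D 4 x / 24 + z * D 2 x * D 3 x / 144]"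
  by (rule jet_rewrite[OF jet_eps_power[OF jet_smult[of "\<lambda>_. 1 / 12", OF _ jet_D2], of 2]])
     (simp_all add: eval_nat_numeral)

lemma tame_D2_proposed: "tame (\<lambda>\<epsilon> p. D 2 (proposed \<epsilon> p) / 12)"
  by (intro tame_divide jet_tame[OF jet_D2])

lemma jet_ln_scale: "jet (\<lambda>\<epsilon> p. ln (rel_scale \<epsilon> (proposed \<epsilon> p)))
     [\<lambda>_. 0,
      \<lambda>_. 0,
      \<lambda>(x, z). D 2 x / 12,
      \<lambda>(x, z). z * D 3 x / 12,
      \<lambda>(x, z). z^2 * D 4 x / 24 + D 1 x * D 3 x / 24 - D 2 x^2 / 288,
      \<lambda>(x, z). z^3 * D 5 x / 72 + z * D 1 x * D 4 x / 24]"
proof -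
  have "\<forall>\<^sub>F \<epsilon> in at_right 0. \<forall>p. \<bar>\<epsilon>^2 * (D 2 (proposed \<epsilon> p) / 12)\<bar> \<le> 1 / 2"
    using eventually_small_curvature by eventually_elim blast
  note remainder = jet_second_order[OF ln_1p_second_order tame_D2_proposed this]
  show ?thesis
    by (rule jet_rewrite[OF jet_add[OF remainder jet_add[OF jet_scale_excess
      jet_smult[of "\<lambda>_. -1 / 2", OF _ jet_mult[OF jet_scale_excess jet_scale_excess]]]]])
      (simp_all add: rel_scale_def eval_nat_numeral, (simp_all add: field_simps)?)
qed

lemma jet_inverse_scale: "jet (\<lambda>\<epsilon> p. 1 / rel_scale \<epsilon> (proposed \<epsilon> p))
     [\<lambda>_. 1,
      \<lambda>_. 0,
      \<lambda>(x, z). - (D 2 x / 12),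
      \<lambda>(x, z). - (z * D 3 x / 12),
      \<lambda>(x, z). - (z^2 * D 4 x / 24) - D 1 x * D 3 x / 24 + D 2 x^2 / 144,
      \<lambda>(x, z). - (z^3 * D 5 x / 72) - z * D 1 x * D 4 x / 24 + z * D 2 x * D 3 x / 144]"
proof -
  have "\<forall>\<^sub>F \<epsilon> in at_right 0. \<forall>p. \<bar>\<epsilon>^2 * (D 2 (proposed \<epsilon> p) / 12)\<bar> \<le> 1 / 2"
    using eventually_small_curvature by eventually_elim blast
  note remainder = jet_second_order[OF inverse_1p_second_order tame_D2_proposed this]
  show ?thesis
    by (rule jet_rewrite[OF jet_add[OF remainder jet_add[OF jet_indep[OF tame_const[of 1], of 5] jet_add[OF jet_smult[of "\<lambda>_. -1", OF _ jet_scale_excess] jet_mult[OF jet_scale_excess jet_scale_excess]]]]])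
      (simp_all add: rel_scale_def eval_nat_numeral, (simp_all add: field_simps)?)
qed

text \<open>
  Up to the factor \<open>-\<epsilon>\<close> this is \<open>x - m(y)\<close>, the deviation of the old point \<open>x\<close> from the mean \<open>m(y)\<close> of a
  move that starts at the proposed point \<open>y\<close>.
\<close>

definition back_incr :: "real \<Rightarrow> real \<times> real \<Rightarrow> real" where
  "back_incr \<epsilon> p = scaled_incr \<epsilon> p + \<epsilon> * (D 1 (proposed \<epsilon> p) / 2)
     - \<epsilon>^3 * ((D 2 (proposed \<epsilon> p) * D 1 (proposed \<epsilon> p) + D 3 (proposed \<epsilon> p)) / 24)"

text \<open>
  Minus the noise that would carry the proposed point back to the old one.
\<close>

definition back_noise :: "real \<Rightarrow> real \<times> real \<Rightarrow> real" where
  "back_noise \<epsilon> p = back_incr \<epsilon> p / rel_scale \<epsilon> (proposed \<epsilon> p)"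

text \<open>
  The logarithm of the one-coordinate ratio \<open>\<pi>(y) q(y, x) / (\<pi>(x) q(x, y))\<close> in the variables
  \<open>(x, z)\<close>, where \<open>z\<close> is the noise of the forward move; see \<open>pair_log_ratio_proposed\<close>.
\<close>

definition log_ratio :: "real \<Rightarrow> real \<times> real \<Rightarrow> real" where
  "log_ratio \<epsilon> p = g (proposed \<epsilon> p) - g (fst p) + ln (rel_scale \<epsilon> (fst p)) - ln (rel_scale \<epsilon> (proposed \<epsilon> p))
     + (snd p)^2 / 2 - (back_noise \<epsilon> p)^2 / 2"

lemma jet_back_incr: "jet back_incr
     [\<lambda>(x, z). z,
      \<lambda>(x, z). D 1 x,
      \<lambda>(x, z). 7 * z * D 2 x / 12,
      \<lambda>(x, z). z^2 * D 3 x / 4 + D 1 x * D 2 x / 6 - D 3 x / 12,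
      \<lambda>(x, z). z^3 * D 4 x / 12 + 5 * z * D 1 x * D 3 x / 24 - z * D 4 x / 24,
      \<lambda>(x, z). z^4 * D 5 x / 48 + 5 * z^2 * D 1 x * D 4 x / 48 - z^2 * D 2 x * D 3 x / 48 - z^2 * D 5 x / 48 + D 1 x^2 * D 3 x / 24 - D 1 x * D 2 x^2 / 24 - D 1 x * D 4 x / 48 - D 2 x * D 3 x / 48]"
  by (rule jet_rewrite[OF jet_add[OF jet_add[OF jet_scaled_incr
        jet_eps[OF jet_smult[of "\<lambda>_. 1 / 2", OF _ jet_D1]]]
        jet_eps_power[OF jet_smult[of "\<lambda>_. - 1 / 24", OF _ jet_add[OF jet_mult[OF jet_D2 jet_D1] jet_D3]], of 3]]])
     (simp_all add: back_incr_def eval_nat_numeral, (simp_all add: field_simps)?)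

lemma jet_back_noise: "jet back_noise
     [\<lambda>(x, z). z,
      \<lambda>(x, z). D 1 x,
      \<lambda>(x, z). z * D 2 x / 2,
      \<lambda>(x, z). z^2 * D 3 x / 6 + D 1 x * D 2 x / 12 - D 3 x / 12,
      \<lambda>(x, z). z^3 * D 4 x / 24 + z * D 1 x * D 3 x / 12 - z * D 2 x^2 / 24 - z * D 4 x / 24,
      \<lambda>(x, z). z^4 * D 5 x / 144 + z^2 * D 1 x * D 4 x / 48 - z^2 * D 2 x * D 3 x / 12 - z^2 * D 5 x / 48 - 7 * D 1 x * D 2 x^2 / 144 - D 1 x * D 4 x / 48 - D 2 x * D 3 x / 72]"
  by (rule jet_rewrite[OF jet_mult[OF jet_back_incr jet_inverse_scale]])
     (simp_all add: back_noise_def, (simp_all add: field_simps eval_nat_numeral)?)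

lemma jet_back_noise_squared: "jet (\<lambda>\<epsilon> p. (back_noise \<epsilon> p)^2)
     [\<lambda>(x, z). z^2,
      \<lambda>(x, z). 2 * z * D 1 x,
      \<lambda>(x, z). z^2 * D 2 x + D 1 x^2,
      \<lambda>(x, z). z^3 * D 3 x / 3 + 7 * z * D 1 x * D 2 x / 6 - z * D 3 x / 6,
      \<lambda>(x, z). z^4 * D 4 x / 12 + z^2 * D 1 x * D 3 x / 2 + z^2 * D 2 x^2 / 6 - z^2 * D 4 x / 12 + D 1 x^2 * D 2 x / 6 - D 1 x * D 3 x / 6,
      \<lambda>(x, z). z^5 * D 5 x / 72 + z^3 * D 1 x * D 4 x / 8 - z^3 * D 5 x / 24 + z * D 1 x^2 * D 3 x / 6 - 7 * z * D 1 x * D 2 x^2 / 72 - z * D 1 x * D 4 x / 8 - z * D 2 x * D 3 x / 9]"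
  by (rule jet_rewrite[OF jet_mult[OF jet_back_noise jet_back_noise]])
     (simp_all add: power2_eq_square, (simp_all add: field_simps eval_nat_numeral)?)

lemma jet_ln_scale_start: "jet (\<lambda>\<epsilon> p. ln (rel_scale \<epsilon> (fst p)))
     [\<lambda>_. 0,
      \<lambda>_. 0,
      \<lambda>(x, z). D 2 x / 12,
      \<lambda>_. 0,
      \<lambda>(x, z). - (D 2 x^2 / 288),
      \<lambda>_. 0]"
proof -
  have "\<forall>\<^sub>F \<epsilon> in at_right 0. \<forall>p::real\<times>real. \<bar>\<epsilon>^2 * (D 2 (fst p) / 12)\<bar> \<le> 1 / 2"
    using eventually_small_curvature by eventually_elim blast
  note remainder = jet_second_order[OF ln_1p_second_order tame_divide[OF tame_D_fst] this]
  have u: "jet (\<lambda>\<epsilon> p. \<epsilon>^2 * (D 2 (fst p) / 12)) [\<lambda>_. 0, \<lambda>_. 0, \<lambda>(x, z). D 2 x / 12, \<lambda>_. 0, \<lambda>_. 0, \<lambda>_. 0]"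
    by (rule jet_rewrite[OF jet_eps_power[OF jet_indep[OF tame_divide[OF tame_D_fst[of 2], of 12], of 3], of 2]])
      (simp_all add: eval_nat_numeral)
  show ?thesis
    by (rule jet_rewrite[OF jet_add[OF remainder jet_add[OF u
      jet_smult[of "\<lambda>_. -1 / 2", OF _ jet_mult[OF u u]]]]])
      (simp_all add: rel_scale_def eval_nat_numeral, (simp_all add: field_simps)?)
qed

lemma c_fM_eq:
  "c_fM g x z = 1 / 720 *
     (z^5 * D 5 x + 5 * z^3 * D 5 x + 15 * z^3 * D 4 x * D 1 x + 15 * z * D 4 x * D 1 x
      + 30 * z^3 * D 3 x * D 2 x + 10 * z * D 3 x * D 2 x
      + 30 * z * D 3 x * (D 1 x)^2 + 35 * z * D 1 x * (D 2 x)^2)"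
  by (simp only: c_fM_def deriv_eq_D)

text \<open>
  The vanishing of the first five coefficients is the property for which fMALA was designed; the
  sixth is the polynomial \<open>c\<close> of the limit.
\<close>

theorem jet_log_ratio: "jet log_ratio [\<lambda>_. 0, \<lambda>_. 0, \<lambda>_. 0, \<lambda>_. 0, \<lambda>_. 0, \<lambda>(x, z). c_fM g x z]"
  by (rule jet_rewrite[OF jet_add[OF jet_add[OF jet_D0_diff jet_ln_scale_start]
        jet_add[OF jet_smult[of "\<lambda>_. - 1", OF _ jet_ln_scale]
        jet_add[OF jet_indep[OF tame_divide[OF tame_power[OF tame_snd, of 2], of 2], of 5]
                   jet_smult[of "\<lambda>_. - 1 / 2", OF _ jet_back_noise_squared]]]]])
     (simp_all add: log_ratio_def c_fM_eq eval_nat_numeral, (simp_all add: field_simps)?)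

lemma c_fM_poly_bound: "\<exists>C n. \<forall>p. \<bar>c_fM g (fst p) (snd p)\<bar> \<le> C * weight p ^ n"
proof -
  have "tame (\<lambda>_ p. c_fM g (fst p) (snd p))"
    unfolding c_fM_eq by (intro tame_intros tame_const tame_snd tame_D_fst) auto
  then obtain C n where "\<forall>\<^sub>F \<epsilon> in at_right (0::real). \<forall>p. \<bar>c_fM g (fst p) (snd p)\<bar> \<le> C * weight p ^ n"
    unfolding tame_def by blast
  then show ?thesis by auto
qed

text \<open>
  The jet unfolded into a pointwise estimate that can be integrated over \<open>(x, z)\<close>.
\<close>

theorem log_ratio_expansion:
  "\<exists>C n. \<forall>\<^sub>F \<epsilon> in at_right 0. \<forall>p.
     \<bar>log_ratio \<epsilon> p - \<epsilon>^5 * c_fM g (fst p) (snd p)\<bar> \<le> \<epsilon>^6 * (C * weight p ^ n)"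
proof -
  from jet_log_ratio have "tame (\<lambda>\<epsilon> p. (log_ratio \<epsilon> p / \<epsilon> / \<epsilon> / \<epsilon> / \<epsilon> / \<epsilon> - c_fM g (fst p) (snd p)) / \<epsilon>)"
    by (simp add: case_prod_beta)
  then obtain C n where C: "\<forall>\<^sub>F \<epsilon> in at_right 0. \<forall>p.
      \<bar>(log_ratio \<epsilon> p / \<epsilon> / \<epsilon> / \<epsilon> / \<epsilon> / \<epsilon> - c_fM g (fst p) (snd p)) / \<epsilon>\<bar> \<le> C * weight p ^ n"
    unfolding tame_def by blast
  have "\<forall>\<^sub>F \<epsilon> in at_right 0. \<forall>p.
     \<bar>log_ratio \<epsilon> p - \<epsilon>^5 * c_fM g (fst p) (snd p)\<bar> \<le> \<epsilon>^6 * (C * weight p ^ n)"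
    using C eventually_at_right_0_small[of 1, simplified]
  proof eventually_elim
    case (elim \<epsilon>)
    show ?case
    proof
      fix p
      have "log_ratio \<epsilon> p - \<epsilon>^5 * c_fM g (fst p) (snd p)
          = \<epsilon>^6 * ((log_ratio \<epsilon> p / \<epsilon> / \<epsilon> / \<epsilon> / \<epsilon> / \<epsilon> - c_fM g (fst p) (snd p)) / \<epsilon>)"
        using elim by (simp add: field_simps eval_nat_numeral)
      also have "\<bar>\<dots>\<bar> \<le> \<epsilon>^6 * (C * weight p ^ n)"
        using elim(2) unfolding abs_mult by (intro mult_mono elim(1)[rule_format]) simp_all
      finally show "\<bar>log_ratio \<epsilon> p - \<epsilon>^5 * c_fM g (fst p) (snd p)\<bar> \<le> \<epsilon>^6 * (C * weight p ^ n)" .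
    qed
  qed
  then show ?thesis by blast
qed

end

section \<open>The symmetrised characteristic integrand\<close>

lemma abs_exp_minus_linear_le:
  fixes r :: real
  assumes "\<bar>r\<bar> \<le> 1"
  shows "\<bar>exp r - 1 - r\<bar> \<le> r^2"
proof -
  have "exp r \<le> 1 + r + r^2"
  proof (cases "0 \<le> r")
    case True
    then show ?thesis using assms exp_bound[of r] by simp
  next
    case False
    \<comment> \<open>for negative \<open>r\<close> invert the lower bound \<open>1 + s + s\<^sup>2/2 \<le> exp s\<close>\<close>
    define s where "s = - r"
    have s: "0 \<le> s" using False by (simp add: s_def)
    have "1 \<le> (1 - s + s^2) * (1 + s + s^2 / 2)"
    proof -
      have "(1 - s + s^2) * (1 + s + s^2 / 2) = 1 + s^2 / 2 + s^3 / 2 + s^4 / 2"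
        by (simp add: field_simps eval_nat_numeral)
      then show ?thesis using s by simp
    qed
    also have "\<dots> \<le> (1 - s + s^2) * exp s"
    proof (rule mult_left_mono[OF exp_lower_Taylor_quadratic[OF s]])
      have "0 \<le> (s - 1/2)^2" by simp
      then show "0 \<le> 1 - s + s^2" by (simp add: power2_eq_square field_simps)
    qed
    finally have "exp (- s) \<le> 1 - s + s^2"
      by (simp add: exp_minus field_simps)
    then show ?thesis by (simp add: s_def)
  qed
  moreover have "1 + r \<le> exp r" by (rule exp_ge_add_one_self)
  ultimately show ?thesis using zero_le_power2[of r] by linarith
qed

text \<open>
  Let \<open>\<phi>(r) = exp(itr) - 1\<close>. Where \<open>\<bar>r\<bar> \<le> 1\<close> this is the average of \<open>\<phi>(r)\<close> and
  \<open>exp(r) \<phi>(-r)\<close>, which reversibility makes interchangeable under the expectation; elsewhere it is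
  \<open>\<phi>\<close> itself. The truncation keeps \<open>exp(r)\<close> bounded.
\<close>

definition sym_char :: "real \<Rightarrow> real \<Rightarrow> complex" where
  "sym_char t r = (if \<bar>r\<bar> \<le> 1 then (iexp (t * r) - 1 + exp r *\<^sub>R (iexp (t * (- r)) - 1)) / 2 else iexp (t * r) - 1)"

text \<open>
  The exponent of the characteristic function of a Gaussian with mean \<open>-1/2\<close> and variance \<open>1\<close>.
\<close>

definition lan_exponent :: "real \<Rightarrow> complex" where
  "lan_exponent t = - (of_real (t^2) + \<i> * of_real t) / 2"

lemma iexp_second_order: "cmod (iexp a - (1 + \<i> * a - of_real (a^2 / 2))) \<le> \<bar>a\<bar>^3 / 6"
  using iexp_approx1[of a 2] by (simp add: eval_nat_numeral algebra_simps)

text \<open>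
  The linear terms \<open>itr\<close> and \<open>-itr\<close> cancel in the average, and the quadratic term gains
  \<open>-i t r\<^sup>2 / 2\<close> from the factor \<open>exp(r) = 1 + r + \<dots>\<close>. For \<open>\<bar>r\<bar> > 1\<close> the cubic bound is trivial,
  since \<open>\<phi>\<close> is bounded.
\<close>

lemma sym_char_quadratic:
  "\<exists>C\<ge>0. \<forall>r. cmod (sym_char t r - lan_exponent t * of_real (r^2)) \<le> C * \<bar>r\<bar>^3"
proof -
  define T where "T = \<bar>t\<bar>"
  define L where "L = cmod (lan_exponent t)"
  \<comment> \<open>\<open>2 + L\<close> serves for \<open>\<bar>r\<bar> > 1\<close>; the powers of \<open>T\<close> collect the Taylor remainders for \<open>\<bar>r\<bar> \<le> 1\<close>\<close>
  define C where "C = 2 + L + T + T^2 + 3 * T^3"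
  have T: "0 \<le> T" and L: "0 \<le> L" by (simp_all add: T_def L_def)
  have C: "0 \<le> C" using T L by (simp add: C_def)
  have "cmod (sym_char t r - lan_exponent t * of_real (r^2)) \<le> C * \<bar>r\<bar>^3" for r
  proof (cases "\<bar>r\<bar> \<le> 1")
    case False
    then have 1: "1 \<le> \<bar>r\<bar>^3" "\<bar>r\<bar>^2 \<le> \<bar>r\<bar>^3"
      using one_le_power[of "\<bar>r\<bar>" 3] power_increasing[of 2 3 "\<bar>r\<bar>"] by simp_all
    have "cmod (sym_char t r - lan_exponent t * of_real (r^2)) \<le> cmod (iexp (t * r) - 1) + L * \<bar>r\<bar>^2"
      using False norm_triangle_ineq4[of "iexp (t * r) - 1" "lan_exponent t * of_real (r^2)"]
      by (simp add: sym_char_def norm_mult L_def norm_power)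
    also have "cmod (iexp (t * r) - 1) \<le> 2"
      using norm_triangle_ineq4[of "iexp (t * r)" 1] by simp
    also have "2 + L * \<bar>r\<bar>^2 \<le> 2 * \<bar>r\<bar>^3 + L * \<bar>r\<bar>^3"
      using 1 L by (intro add_mono mult_left_mono) auto
    also have "\<dots> \<le> C * \<bar>r\<bar>^3"
      using T by (simp add: C_def algebra_simps add_nonneg_nonneg)
    finally show ?thesis by simp
  next
    case True
    define a where "a = t * r"
    define e1 where "e1 = iexp a - (1 + \<i> * a - of_real (a^2 / 2))"
    define e2 where "e2 = iexp (- a) - (1 - \<i> * a - of_real (a^2 / 2))"
    define e3 where "e3 = exp r - 1 - r"
    have abs_a: "\<bar>a\<bar> = T * \<bar>r\<bar>" by (simp add: a_def T_def abs_mult)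
    have e1: "cmod e1 \<le> (T * \<bar>r\<bar>)^3"
      using iexp_second_order[of a] zero_le_power[OF abs_ge_zero[of a], of 3]
      unfolding e1_def abs_a[symmetric] by linarith
    have "e2 = iexp (- a) - (1 + \<i> * of_real (- a) - of_real ((- a)^2 / 2))"
      by (simp add: e2_def)
    then have "cmod e2 \<le> \<bar>a\<bar>^3 / 6"
      using iexp_second_order[of "- a"] by (simp only: abs_minus_cancel)
    then have e2: "cmod e2 \<le> (T * \<bar>r\<bar>)^3"
      using zero_le_power[OF abs_ge_zero[of a], of 3] unfolding abs_a[symmetric] by linarith
    have e3: "\<bar>e3\<bar> \<le> \<bar>r\<bar>^2" using abs_exp_minus_linear_le[OF True] by (simp add: e3_def)
    have e4: "cmod (iexp (- a) - 1) \<le> T * \<bar>r\<bar>"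
      using iexp_approx1[of "-a" 0] abs_a by simp
    have "sym_char t r - lan_exponent t * of_real (r^2)
        = (e1 + e2 + of_real r * (e2 - of_real (a^2 / 2)) + of_real e3 * (iexp (- a) - 1)) / 2"
      using True
      by (simp add: sym_char_def lan_exponent_def scaleR_conv_of_real e1_def e2_def e3_def flip: a_def)
        (simp add: a_def field_simps power2_eq_square)
    also have "cmod \<dots> \<le> (cmod e1 + cmod e2 + \<bar>r\<bar> * (cmod e2 + a^2 / 2) + \<bar>e3\<bar> * cmod (iexp (- a) - 1)) / 2"
    proof -
      have "cmod (e1 + e2 + of_real r * (e2 - of_real (a^2 / 2)) + of_real e3 * (iexp (- a) - 1))
         \<le> cmod e1 + cmod e2 + cmod (of_real r * (e2 - of_real (a^2 / 2))) + cmod (of_real e3 * (iexp (- a) - 1))"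
        by (intro norm_triangle_mono order_refl)
      moreover have "cmod (of_real r * (e2 - of_real (a^2 / 2))) \<le> \<bar>r\<bar> * (cmod e2 + a^2 / 2)"
        unfolding norm_mult using norm_triangle_ineq4[of e2 "of_real (a^2 / 2)"]
        by (intro mult_mono) (simp_all add: norm_divide norm_power)
      moreover have "cmod (of_real e3 * (iexp (- a) - 1)) = \<bar>e3\<bar> * cmod (iexp (- a) - 1)"
        by (simp add: norm_mult)
      ultimately show ?thesis by (simp add: norm_divide)
    qed
    also have "\<dots> \<le> ((T * \<bar>r\<bar>)^3 + (T * \<bar>r\<bar>)^3 + \<bar>r\<bar> * ((T * \<bar>r\<bar>)^3 + (T * \<bar>r\<bar>)^2) + \<bar>r\<bar>^2 * (T * \<bar>r\<bar>)) / 2"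
    proof -
      have "a^2 / 2 \<le> (T * \<bar>r\<bar>)^2" by (simp flip: abs_a)
      then show ?thesis using e1 e2 e3 e4 T
        by (intro divide_right_mono add_mono mult_mono) auto
    qed
    also have "\<dots> = (2 * T^3 + T^3 * \<bar>r\<bar> + T^2 + T) * \<bar>r\<bar>^3 / 2"
      by (simp add: algebra_simps eval_nat_numeral)
    also have "\<dots> \<le> (2 * T^3 + T^3 * 1 + T^2 + T) * \<bar>r\<bar>^3 / 1"
      using True T by (intro frac_le mult_right_mono add_mono mult_left_mono mult_nonneg_nonneg add_nonneg_nonneg) auto
    also have "\<dots> \<le> C * \<bar>r\<bar>^3"
      unfolding C_def div_by_1 using L by (intro mult_right_mono) auto
    finally show ?thesis .
  qed
  with C show ?thesis by blast
qed

section \<open>Reversibility of one coordinate\<close>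

context fmala_target
begin

abbreviation noise :: "real measure" where "noise \<equiv> std_normal_distribution"

text \<open>
  Density of one coordinate of the pair (current state, proposal) at stationarity.
\<close>

definition joint :: "real \<Rightarrow> real \<Rightarrow> real \<Rightarrow> real" where
  "joint \<epsilon> x y = target1_density g x * normal_density (fmala_mean g (\<epsilon>^2) x) (fmala_scale g (\<epsilon>^2) x) y"

definition pair_log_ratio :: "real \<Rightarrow> real \<Rightarrow> real \<Rightarrow> real" where
  "pair_log_ratio \<epsilon> x y = ln (joint \<epsilon> y x / joint \<epsilon> x y)"

lemma measurable_g [measurable]: "g \<in> borel_measurable borel"
  using measurable_D[of 0] by (simp add: D_0)

lemma measurable_mean [measurable]: "fmala_mean g h \<in> borel_measurable borel"
  unfolding fmala_mean_def deriv_eq_D by measurable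

lemma measurable_scale [measurable]: "fmala_scale g h \<in> borel_measurable borel"
  unfolding fmala_scale_def deriv_eq_D by measurable

lemma measurable_target1 [measurable]: "target1_density g \<in> borel_measurable borel"
  unfolding target1_density_def by measurable

lemma measurable_joint [measurable (raw)]:
  assumes [measurable]: "f \<in> borel_measurable M" "h \<in> borel_measurable M"
  shows "(\<lambda>w. joint \<epsilon> (f w) (h w)) \<in> borel_measurable M"
  unfolding joint_def normal_density_def by measurable

lemma measurable_pair_log_ratio [measurable (raw)]:
  assumes [measurable]: "f \<in> borel_measurable M" "h \<in> borel_measurable M"
  shows "(\<lambda>w. pair_log_ratio \<epsilon> (f w) (h w)) \<in> borel_measurable M"
  unfolding pair_log_ratio_def by measurable

lemma measurable_proposed [measurable]: "proposed \<epsilon> \<in> borel_measurable (borel \<Otimes>\<^sub>M borel)"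
  unfolding proposed_def scaled_incr_def case_prod_beta by measurable

lemma measurable_c_fM [measurable]: "(\<lambda>p. c_fM g (fst p) (snd p)) \<in> borel_measurable (borel \<Otimes>\<^sub>M borel)"
  unfolding c_fM_eq by measurable

lemma integrable_exp_g: "integrable lborel (\<lambda>t. exp (g t))"
  using integrable_moments[of 0] by simp

lemma integral_exp_g_pos: "0 < (\<integral>t. exp (g t) \<partial>lborel)"
proof -
  have "(\<integral>t. exp (g t) \<partial>lborel) \<noteq> 0"
  proof
    assume "(\<integral>t. exp (g t) \<partial>lborel) = 0"
    then have "AE t in lborel. exp (g t) = 0"
      using integrable_exp_g by (subst (asm) integral_nonneg_eq_0_iff_AE) auto
    then have "AE t in (lborel::real measure). False" by simp
    then show False by (simp add: AE_iff_null null_sets_def)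
  qed
  then show ?thesis by (simp add: order.not_eq_order_implies_strict)
qed

lemma target1_density_pos: "0 < target1_density g t"
  using integral_exp_g_pos by (simp add: target1_density_def)

abbreviation target1 :: "real measure" where
  "target1 \<equiv> density lborel (\<lambda>t. ennreal (target1_density g t))"

lemma prob_space_target1: "prob_space target1"
proof
  have "integrable lborel (target1_density g)"
    using integrable_exp_g unfolding target1_density_def by simp
  moreover have "(\<integral>t. target1_density g t \<partial>lborel) = 1"
    using integral_exp_g_pos unfolding target1_density_def by simp
  ultimately have "(\<integral>\<^sup>+t. ennreal (target1_density g t) \<partial>lborel) = 1"
    using target1_density_pos by (subst nn_integral_eq_integral) (auto intro: less_imp_le)
  then show "emeasure target1 (space target1) = 1"
    by (simp add: emeasure_density)
qed

sublocale target1: prob_space target1 by (rule prob_space_target1)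

sublocale noise: prob_space noise by (rule prob_space_normal_density) simp

sublocale start: pair_prob_space target1 noise ..

text \<open>
  All scales are positive, so the proposal has a positive density everywhere.
\<close>

definition small_step :: "real \<Rightarrow> bool" where
  "small_step \<epsilon> \<longleftrightarrow> 0 < \<epsilon> \<and> (\<forall>t. 0 < rel_scale \<epsilon> t)"

lemma eventually_small_step: "\<forall>\<^sub>F \<epsilon> in at_right 0. small_step \<epsilon>"
  using eventually_small_curvature eventually_at_right_0_small[of 1, simplified]
proof eventually_elim
  case (elim \<epsilon>)
  have "0 < rel_scale \<epsilon> t" for t
    using elim(1)[rule_format, of t] unfolding rel_scale_def by linarith
  then show ?case using elim(2) by (simp add: small_step_def)
qed

lemma fmala_scale_eq: "0 < \<epsilon> \<Longrightarrow> fmala_scale g (\<epsilon>^2) t = \<epsilon> * rel_scale \<epsilon> t"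
proof -
  assume \<epsilon>: "0 < \<epsilon>"
  have "(\<epsilon>^2) powr (1/2) = \<epsilon>" "(\<epsilon>^2) powr (3/2) = \<epsilon>^3"
    using \<epsilon> powr_powr[of \<epsilon> 2 "1/2"] powr_powr[of \<epsilon> 2 "3/2"] by simp_all
  then show ?thesis
    unfolding fmala_scale_def rel_scale_def deriv_eq_D
    by (simp add: algebra_simps power2_eq_square power3_eq_cube)
qed

lemma proposed_eq: "0 < \<epsilon> \<Longrightarrow> fmala_mean g (\<epsilon>^2) x + fmala_scale g (\<epsilon>^2) x * z = proposed \<epsilon> (x, z)"
  by (simp add: fmala_scale_eq rel_scale_def proposed_def scaled_incr_def fmala_mean_def deriv_eq_D)
     (simp add: field_simps power2_eq_square power3_eq_cube power4_eq_xxxx)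

lemma back_incr_eq: "fst p - fmala_mean g (\<epsilon>^2) (proposed \<epsilon> p) = - (\<epsilon> * back_incr \<epsilon> p)"
  by (simp add: back_incr_def fmala_mean_def deriv_eq_D)
     (simp add: proposed_def field_simps power2_eq_square power3_eq_cube power4_eq_xxxx)

lemma joint_pos: "small_step \<epsilon> \<Longrightarrow> 0 < joint \<epsilon> x y"
proof -
  assume s: "small_step \<epsilon>"
  then have "0 < fmala_scale g (\<epsilon>^2) x" by (simp add: small_step_def fmala_scale_eq)
  then show ?thesis
    unfolding joint_def by (intro mult_pos_pos target1_density_pos normal_density_pos)
qed

lemma joint_swap: "small_step \<epsilon> \<Longrightarrow> joint \<epsilon> y x = joint \<epsilon> x y * exp (pair_log_ratio \<epsilon> x y)"
  using joint_pos[of \<epsilon> x y] joint_pos[of \<epsilon> y x] by (simp add: pair_log_ratio_def)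

lemma pair_log_ratio_swap: "small_step \<epsilon> \<Longrightarrow> pair_log_ratio \<epsilon> y x = - pair_log_ratio \<epsilon> x y"
  using joint_pos[of \<epsilon> x y] joint_pos[of \<epsilon> y x] by (simp add: pair_log_ratio_def ln_div)

lemma ln_joint:
  assumes "small_step \<epsilon>"
  shows "ln (joint \<epsilon> x y) = g x - ln (\<integral>s. exp (g s) \<partial>lborel) - ln (sqrt (2 * pi)) - ln \<epsilon> - ln (rel_scale \<epsilon> x)
     - (y - fmala_mean g (\<epsilon>^2) x)^2 / (2 * (\<epsilon> * rel_scale \<epsilon> x)^2)"
proof -
  have \<epsilon>: "0 < \<epsilon>" and r: "0 < rel_scale \<epsilon> x" using assms by (simp_all add: small_step_def)
  have "normal_density (fmala_mean g (\<epsilon>^2) x) (fmala_scale g (\<epsilon>^2) x) y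
      = 1 / (sqrt (2 * pi) * (\<epsilon> * rel_scale \<epsilon> x)) * exp (- ((y - fmala_mean g (\<epsilon>^2) x)^2 / (2 * (\<epsilon> * rel_scale \<epsilon> x)^2)))"
    unfolding normal_density_def fmala_scale_eq[OF \<epsilon>] using \<epsilon> r by (simp add: real_sqrt_mult)
  then show ?thesis
    unfolding joint_def target1_density_def
    using \<epsilon> r integral_exp_g_pos by (simp add: ln_mult ln_div)
qed

lemma pair_log_ratio_proposed:
  assumes "small_step \<epsilon>"
  shows "pair_log_ratio \<epsilon> (fst p) (proposed \<epsilon> p) = log_ratio \<epsilon> p"
proof -
  let ?y = "proposed \<epsilon> p"
  have \<epsilon>: "0 < \<epsilon>" and r: "\<And>t. 0 < rel_scale \<epsilon> t" using assms by (simp_all add: small_step_def)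
  have forth: "?y - fmala_mean g (\<epsilon>^2) (fst p) = \<epsilon> * rel_scale \<epsilon> (fst p) * snd p"
    using proposed_eq[OF \<epsilon>, of "fst p" "snd p"] fmala_scale_eq[OF \<epsilon>, of "fst p"] by simp
  have "pair_log_ratio \<epsilon> (fst p) ?y = ln (joint \<epsilon> ?y (fst p)) - ln (joint \<epsilon> (fst p) ?y)"
    using joint_pos[OF assms, of "fst p" ?y] joint_pos[OF assms, of ?y "fst p"]
    by (simp add: pair_log_ratio_def ln_div)
  also have "\<dots> = log_ratio \<epsilon> p"
    unfolding ln_joint[OF assms] forth back_incr_eq
    using \<epsilon> r[of "fst p"] r[of ?y]
    by (simp add: log_ratio_def back_noise_def power_mult_distrib power_divide)
  finally show ?thesis .
qed

definition pair_law :: "real \<Rightarrow> (real \<times> real) measure" where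
  "pair_law \<epsilon> = density (lborel \<Otimes>\<^sub>M lborel) (\<lambda>(x, y). ennreal (joint \<epsilon> x y))"

lemma sets_pair_law [measurable_cong]: "sets (pair_law \<epsilon>) = sets (borel \<Otimes>\<^sub>M borel)"
  unfolding pair_law_def sets_density by (intro sets_pair_measure_cong) auto

lemma sets_start [measurable_cong]: "sets (target1 \<Otimes>\<^sub>M noise) = sets (borel \<Otimes>\<^sub>M borel)"
  by (intro sets_pair_measure_cong) auto

text \<open>
  Passage between the variables \<open>(x, y)\<close>, in which reversal is a swap, and \<open>(x, z)\<close>, in which the
  underlying measure does not depend on \<open>\<epsilon>\<close> and the expansion holds.
\<close>

lemma pair_law_eq_distr:
  assumes "small_step \<epsilon>"
  shows "pair_law \<epsilon> = distr (target1 \<Otimes>\<^sub>M noise) (borel \<Otimes>\<^sub>M borel) (\<lambda>p. (fst p, proposed \<epsilon> p))"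
proof (rule measure_eqI)
  show "sets (pair_law \<epsilon>) = sets (distr (target1 \<Otimes>\<^sub>M noise) (borel \<Otimes>\<^sub>M borel) (\<lambda>p. (fst p, proposed \<epsilon> p)))"
    by (simp add: sets_pair_law)
  have \<epsilon>: "0 < \<epsilon>" using assms by (simp add: small_step_def)
  fix A assume "A \<in> sets (pair_law \<epsilon>)"
  then have A [measurable]: "A \<in> sets (borel \<Otimes>\<^sub>M borel)" by (simp add: sets_pair_law)
  have A' [measurable]: "A \<in> sets (lborel \<Otimes>\<^sub>M lborel)"
    using A by (simp cong: sets_pair_measure_cong)
  have inner: "(\<integral>\<^sup>+z. indicator A (x, proposed \<epsilon> (x, z)) \<partial>noise)
      = (\<integral>\<^sup>+y. ennreal (normal_density (fmala_mean g (\<epsilon>^2) x) (fmala_scale g (\<epsilon>^2) x) y) * indicator A (x, y) \<partial>lborel)" for x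
  proof -
    let ?m = "fmala_mean g (\<epsilon>^2) x" and ?s = "fmala_scale g (\<epsilon>^2) x"
    have "0 < ?s" using assms fmala_scale_eq[OF \<epsilon>, of x] by (simp add: small_step_def)
    then have nz: "?s \<noteq> 0" by simp
    have "(\<integral>\<^sup>+z. indicator A (x, proposed \<epsilon> (x, z)) \<partial>noise)
        = (\<integral>\<^sup>+y. indicator A (x, y) \<partial>distr noise lborel (\<lambda>t. ?m + ?s * t))"
      by (subst nn_integral_distr) (auto simp: proposed_eq[OF \<epsilon>])
    also have "\<dots> = (\<integral>\<^sup>+y. indicator A (x, y) \<partial>density lborel (normal_density ?m ?s))"
      unfolding distr_std_normal_affine[OF nz] ..
    also have "\<dots> = (\<integral>\<^sup>+y. ennreal (normal_density ?m ?s y) * indicator A (x, y) \<partial>lborel)"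
      by (subst nn_integral_density) auto
    finally show ?thesis .
  qed
  have "emeasure (distr (target1 \<Otimes>\<^sub>M noise) (borel \<Otimes>\<^sub>M borel) (\<lambda>p. (fst p, proposed \<epsilon> p))) A
      = (\<integral>\<^sup>+p. indicator A p \<partial>distr (target1 \<Otimes>\<^sub>M noise) (borel \<Otimes>\<^sub>M borel) (\<lambda>p. (fst p, proposed \<epsilon> p)))"
    by simp
  also have "\<dots> = (\<integral>\<^sup>+p. indicator A (fst p, proposed \<epsilon> p) \<partial>(target1 \<Otimes>\<^sub>M noise))"
    by (subst nn_integral_distr) auto
  also have "\<dots> = (\<integral>\<^sup>+x. \<integral>\<^sup>+z. indicator A (x, proposed \<epsilon> (x, z)) \<partial>noise \<partial>target1)"
    by (subst noise.nn_integral_fst[symmetric]) auto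
  also have "\<dots> = (\<integral>\<^sup>+x. ennreal (target1_density g x) * (\<integral>\<^sup>+y. ennreal (normal_density (fmala_mean g (\<epsilon>^2) x) (fmala_scale g (\<epsilon>^2) x) y) * indicator A (x, y) \<partial>lborel) \<partial>lborel)"
    unfolding inner by (subst nn_integral_density) (auto simp: normal_density_def)
  also have "\<dots> = (\<integral>\<^sup>+x. \<integral>\<^sup>+y. ennreal (joint \<epsilon> x y) * indicator A (x, y) \<partial>lborel \<partial>lborel)"
    unfolding joint_def
    by (subst nn_integral_cmult[symmetric])
       (auto simp: ennreal_mult target1_density_pos less_imp_le mult_ac)
  also have "\<dots> = (\<integral>\<^sup>+p. (case p of (x, y) \<Rightarrow> ennreal (joint \<epsilon> x y)) * indicator A p \<partial>(lborel \<Otimes>\<^sub>M lborel))"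
    by (subst lborel.nn_integral_fst[symmetric]) (auto simp: case_prod_beta)
  also have "\<dots> = emeasure (pair_law \<epsilon>) A"
    unfolding pair_law_def by (subst emeasure_density) (auto simp: case_prod_beta)
  finally show "emeasure (pair_law \<epsilon>) A = emeasure (distr (target1 \<Otimes>\<^sub>M noise) (borel \<Otimes>\<^sub>M borel) (\<lambda>p. (fst p, proposed \<epsilon> p))) A" ..
qed

lemma prob_space_pair_law: "small_step \<epsilon> \<Longrightarrow> prob_space (pair_law \<epsilon>)"
  using start.prob_space_distr[of "\<lambda>p. (fst p, proposed \<epsilon> p)" "borel \<Otimes>\<^sub>M borel"]
  by (simp add: pair_law_eq_distr)

lemma integral_pair_law_log_ratio:
  fixes \<phi> :: "real \<Rightarrow> 'b::{banach, second_countable_topology}"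
  assumes "small_step \<epsilon>" and [measurable]: "\<phi> \<in> borel_measurable borel"
  shows "(\<integral>p. \<phi> (pair_log_ratio \<epsilon> (fst p) (snd p)) \<partial>pair_law \<epsilon>) = (\<integral>p. \<phi> (log_ratio \<epsilon> p) \<partial>(target1 \<Otimes>\<^sub>M noise))"
  unfolding pair_law_eq_distr[OF assms(1)]
  by (subst integral_distr) (auto simp: pair_log_ratio_proposed[OF assms(1)])

text \<open>
  Lebesgue measure on the plane is invariant under \<open>(x, y) \<mapsto> (y, x)\<close>, the log ratio changes sign and
  the density is multiplied by the ratio.
\<close>

lemma integral_pair_law_swap:
  fixes \<phi> :: "real \<Rightarrow> complex"
  assumes s: "small_step \<epsilon>" and [measurable]: "\<phi> \<in> borel_measurable borel"
  shows "(\<integral>p. \<phi> (pair_log_ratio \<epsilon> (fst p) (snd p)) \<partial>pair_law \<epsilon>)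
       = (\<integral>p. exp (pair_log_ratio \<epsilon> (fst p) (snd p)) *\<^sub>R \<phi> (- pair_log_ratio \<epsilon> (fst p) (snd p)) \<partial>pair_law \<epsilon>)"
proof -
  interpret lborel_pair: pair_sigma_finite lborel "lborel :: real measure" ..
  have swap: "joint \<epsilon> y x *\<^sub>R \<phi> (pair_log_ratio \<epsilon> y x)
      = joint \<epsilon> x y *\<^sub>R (exp (pair_log_ratio \<epsilon> x y) *\<^sub>R \<phi> (- pair_log_ratio \<epsilon> x y))" for x y
    by (simp add: joint_swap[OF s, where x = x and y = y] pair_log_ratio_swap[OF s, where x = x and y = y])
  have "(\<integral>p. \<phi> (pair_log_ratio \<epsilon> (fst p) (snd p)) \<partial>pair_law \<epsilon>)
      = (\<integral>(x, y). joint \<epsilon> x y *\<^sub>R \<phi> (pair_log_ratio \<epsilon> x y) \<partial>(lborel \<Otimes>\<^sub>M lborel))"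
    unfolding pair_law_def case_prod_beta
    by (subst integral_density) (auto simp: joint_pos[OF s] less_imp_le)
  also have "\<dots> = (\<integral>(x, y). joint \<epsilon> y x *\<^sub>R \<phi> (pair_log_ratio \<epsilon> y x) \<partial>(lborel \<Otimes>\<^sub>M lborel))"
    by (subst lborel_pair.integral_product_swap[symmetric]) (auto simp: case_prod_beta)
  also have "\<dots> = (\<integral>(x, y). joint \<epsilon> x y *\<^sub>R (exp (pair_log_ratio \<epsilon> x y) *\<^sub>R \<phi> (- pair_log_ratio \<epsilon> x y)) \<partial>(lborel \<Otimes>\<^sub>M lborel))"
    unfolding swap ..
  also have "\<dots> = (\<integral>p. exp (pair_log_ratio \<epsilon> (fst p) (snd p)) *\<^sub>R \<phi> (- pair_log_ratio \<epsilon> (fst p) (snd p)) \<partial>pair_law \<epsilon>)"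
    unfolding pair_law_def case_prod_beta
    by (subst integral_density) (auto simp: joint_pos[OF s] less_imp_le)
  finally show ?thesis .
qed

end

section \<open>The characteristic function of one coordinate\<close>

lemma integrable_density_abs_power:
  fixes f :: "real \<Rightarrow> real"
  assumes [measurable]: "f \<in> borel_measurable borel" and nonneg: "\<And>x. 0 \<le> f x"
    and int: "\<And>k. integrable lborel (\<lambda>x. f x * \<bar>x\<bar> ^ k)"
  shows "integrable (density lborel (\<lambda>x. ennreal (f x))) (\<lambda>x. (1 + \<bar>x\<bar>) ^ n)"
proof (subst integrable_density)
  show "AE x in lborel. 0 \<le> f x" using nonneg by simp
  have eq: "f x *\<^sub>R (1 + \<bar>x\<bar>) ^ n = (\<Sum>k\<le>n. of_nat (n choose k) * (f x * \<bar>x\<bar> ^ k))" for x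
    using binomial_ring[of "\<bar>x\<bar>" 1 n] by (simp add: sum_distrib_left algebra_simps)
  show "integrable lborel (\<lambda>x. f x *\<^sub>R (1 + \<bar>x\<bar>) ^ n)"
    unfolding eq using int by simp
qed measurable

context fmala_target
begin

lemma measurable_log_ratio [measurable]: "log_ratio \<epsilon> \<in> borel_measurable (borel \<Otimes>\<^sub>M borel)"
  unfolding log_ratio_def back_noise_def back_incr_def rel_scale_def scaled_incr_def case_prod_beta
  by measurable

lemma measurable_sym_char [measurable]: "sym_char t \<in> borel_measurable borel"
  unfolding sym_char_def by measurable

text \<open>
  Split \<open>exp(itR) - 1\<close> into the part \<open>A\<close> with \<open>\<bar>R\<bar> \<le> 1\<close> and the rest \<open>B\<close>. Reversibility allows
  one to replace \<open>A(R)\<close> by its average with \<open>exp(R) A(-R)\<close>.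
\<close>

lemma char_eq_integral_sym_char:
  assumes s: "small_step \<epsilon>"
  shows "(\<integral>p. iexp (t * log_ratio \<epsilon> p) \<partial>(target1 \<Otimes>\<^sub>M noise)) - 1
       = (\<integral>p. sym_char t (log_ratio \<epsilon> p) \<partial>(target1 \<Otimes>\<^sub>M noise))"
proof -
  interpret J: prob_space "pair_law \<epsilon>" by (rule prob_space_pair_law[OF s])
  let ?R = "\<lambda>p. pair_log_ratio \<epsilon> (fst p) (snd p)"
  define A B where "A r = (if \<bar>r\<bar> \<le> 1 then iexp (t * r) - 1 else 0)"
    and "B r = (if \<bar>r\<bar> \<le> 1 then 0 else iexp (t * r) - 1)" for r
  have [measurable]: "A \<in> borel_measurable borel" "B \<in> borel_measurable borel"
    unfolding A_def B_def by measurable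
  have iexp_bound: "cmod (iexp r - 1) \<le> 2" for r
    using norm_triangle_ineq4[of "iexp r" 1] by simp
  have A_bound: "cmod (A r) \<le> 2" and B_bound: "cmod (B r) \<le> 2" for r
    using iexp_bound[of "t * r"] by (auto simp: A_def B_def)
  have A'_bound: "cmod (exp r *\<^sub>R A (- r)) \<le> exp 1 * 2" for r
  proof (cases "\<bar>r\<bar> \<le> 1")
    case True
    then have "exp r * cmod (A (- r)) \<le> exp 1 * 2"
      by (intro mult_mono A_bound) auto
    then show ?thesis by simp
  qed (simp add: A_def)
  have int: "integrable (pair_law \<epsilon>) (\<lambda>p. A (?R p))" "integrable (pair_law \<epsilon>) (\<lambda>p. B (?R p))"
    "integrable (pair_law \<epsilon>) (\<lambda>p. exp (?R p) *\<^sub>R A (- ?R p))"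
    by (rule J.integrable_const_bound[OF always_eventually], use A_bound in blast, measurable)
       (rule J.integrable_const_bound[OF always_eventually], use B_bound in blast, measurable,
        rule J.integrable_const_bound[OF always_eventually], use A'_bound in blast, measurable)
  have "(\<integral>p. iexp (t * log_ratio \<epsilon> p) \<partial>(target1 \<Otimes>\<^sub>M noise)) = (\<integral>p. iexp (t * ?R p) \<partial>pair_law \<epsilon>)"
    by (rule integral_pair_law_log_ratio[OF s, symmetric]) measurable
  also have "\<dots> = (\<integral>p. 1 + (A (?R p) + B (?R p)) \<partial>pair_law \<epsilon>)"
    by (intro Bochner_Integration.integral_cong) (auto simp: A_def B_def)
  also have "\<dots> = 1 + ((\<integral>p. A (?R p) \<partial>pair_law \<epsilon>) + (\<integral>p. B (?R p) \<partial>pair_law \<epsilon>))"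
    using int by (simp add: J.prob_space)
  also have "(\<integral>p. A (?R p) \<partial>pair_law \<epsilon>)
      = ((\<integral>p. A (?R p) \<partial>pair_law \<epsilon>) + (\<integral>p. exp (?R p) *\<^sub>R A (- ?R p) \<partial>pair_law \<epsilon>)) / 2"
    using integral_pair_law_swap[OF s, of A] by simp
  also have "1 + (\<dots> + (\<integral>p. B (?R p) \<partial>pair_law \<epsilon>))
      = 1 + (\<integral>p. (A (?R p) + exp (?R p) *\<^sub>R A (- ?R p)) / 2 + B (?R p) \<partial>pair_law \<epsilon>)"
    using int by simp
  also have "(\<integral>p. (A (?R p) + exp (?R p) *\<^sub>R A (- ?R p)) / 2 + B (?R p) \<partial>pair_law \<epsilon>)
      = (\<integral>p. sym_char t (?R p) \<partial>pair_law \<epsilon>)"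
    by (intro Bochner_Integration.integral_cong) (auto simp: A_def B_def sym_char_def)
  also have "\<dots> = (\<integral>p. sym_char t (log_ratio \<epsilon> p) \<partial>(target1 \<Otimes>\<^sub>M noise))"
    by (rule integral_pair_law_log_ratio[OF s]) measurable
  finally show ?thesis by simp
qed

lemma integrable_target1_abs_power: "integrable target1 (\<lambda>x. (1 + \<bar>x\<bar>) ^ n)"
proof (rule integrable_density_abs_power)
  have "integrable lborel (\<lambda>x. exp (g x) / (\<integral>s. exp (g s) \<partial>lborel) * \<bar>x\<bar> ^ k)" for k
    using integrable_abs[OF integrable_moments[of k]] by (simp add: abs_mult power_abs mult.commute)
  then show "integrable lborel (\<lambda>x. target1_density g x * \<bar>x\<bar> ^ k)" for k
    unfolding target1_density_def .
qed (simp_all add: target1_density_pos less_imp_le)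

lemma integrable_noise_abs_power: "integrable noise (\<lambda>z. (1 + \<bar>z\<bar>) ^ n)"
  by (rule integrable_density_abs_power) (auto intro: integrable_std_normal_moment_abs)

lemma measurable_weight [measurable]: "weight \<in> borel_measurable (borel \<Otimes>\<^sub>M borel)"
  unfolding weight_def by measurable

lemma integrable_weight_power: "integrable (target1 \<Otimes>\<^sub>M noise) (\<lambda>p. weight p ^ n)"
proof (rule start.Fubini_integrable)
  show "integrable target1 (\<lambda>x. \<integral>z. norm (weight (x, z) ^ n) \<partial>noise)"
  proof -
    have "(\<lambda>x. \<integral>z. norm (weight (x, z) ^ n) \<partial>noise) = (\<lambda>x. (1 + \<bar>x\<bar>) ^ n * (\<integral>z. (1 + \<bar>z\<bar>) ^ n \<partial>noise))"
      by (simp add: weight_def power_mult_distrib abs_mult)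
    then show ?thesis using integrable_target1_abs_power by simp
  qed
  show "AE x in target1. integrable noise (\<lambda>z. weight (x, z) ^ n)"
    using integrable_noise_abs_power by (simp add: weight_def power_mult_distrib)
qed measurable

text \<open>
  With \<open>P\<close> a polynomial bound for both \<open>c\<close> and the remainder of the expansion, \<open>\<bar>R\<bar> \<le> 2 \<epsilon>\<^sup>5 P\<close>. So
  the cubic error of \<open>sym_char\<close> is of order \<open>\<epsilon>\<^sup>1\<^sup>5\<close>, and replacing \<open>R\<^sup>2\<close> by \<open>\<epsilon>\<^sup>1\<^sup>0 c\<^sup>2\<close> costs
  order \<open>\<epsilon>\<^sup>1\<^sup>1\<close>; both are integrable because the state and the noise have all moments.
\<close>

theorem one_coordinate_char:
  "\<exists>C. \<forall>\<^sub>F \<epsilon> in at_right 0.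
     cmod ((\<integral>p. iexp (t * log_ratio \<epsilon> p) \<partial>(target1 \<Otimes>\<^sub>M noise)) - 1
           - lan_exponent t * of_real ((K_fM g)^2 * \<epsilon>^10)) \<le> C * \<epsilon>^11"
proof -
  let ?MN = "target1 \<Otimes>\<^sub>M noise"
  let ?c = "\<lambda>p. c_fM g (fst p) (snd p)"
  obtain C1 n1 where c1: "\<And>p. \<bar>?c p\<bar> \<le> C1 * weight p ^ n1"
    using c_fM_poly_bound by blast
  obtain C2 n2 where c2: "\<forall>\<^sub>F \<epsilon> in at_right 0. \<forall>p. \<bar>log_ratio \<epsilon> p - \<epsilon>^5 * ?c p\<bar> \<le> \<epsilon>^6 * (C2 * weight p ^ n2)"
    using log_ratio_expansion by blast
  obtain C3 where C3: "0 \<le> C3" "\<And>r. cmod (sym_char t r - lan_exponent t * of_real (r^2)) \<le> C3 * \<bar>r\<bar>^3"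
    using sym_char_quadratic by blast
  define Q where "Q = \<bar>C1\<bar> + \<bar>C2\<bar>"
  define P where "P p = Q * weight p ^ (n1 + n2)" for p
  have dom: "C1 * weight p ^ n1 \<le> P p" "C2 * weight p ^ n2 \<le> P p" for p
    unfolding P_def Q_def using weight_ge_1[of p]
    by (auto intro!: mult_mono power_increasing)
  have P0: "0 \<le> P p" for p using c1[of p] dom(1)[of p] by linarith
  have P_int: "integrable ?MN (\<lambda>p. P p ^ k)" for k
    unfolding P_def power_mult_distrib power_mult[symmetric]
    using integrable_weight_power by simp
  have P_meas [measurable]: "P \<in> borel_measurable (borel \<Otimes>\<^sub>M borel)"
    unfolding P_def by measurable
  have c_int: "integrable ?MN (\<lambda>p. (?c p)^2)"
  proof (rule Bochner_Integration.integrable_bound[OF P_int[of 2]])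
    show "AE p in ?MN. norm ((?c p)^2) \<le> norm (P p ^ 2)"
      using power_mono[OF order_trans[OF c1 dom(1)] abs_ge_zero, where n = 2] by simp
  qed measurable
  have K: "(K_fM g)^2 = (\<integral>p. (?c p)^2 \<partial>?MN)"
    unfolding K_fM_def case_prod_beta' by simp
  define L where "L = cmod (lan_exponent t)"
  define H where "H p = C3 * (8 * P p ^ 3) + L * (3 * P p ^ 2)" for p
  have H_int: "integrable ?MN H" unfolding H_def using P_int by simp
  have "\<forall>\<^sub>F \<epsilon> in at_right 0.
     cmod ((\<integral>p. iexp (t * log_ratio \<epsilon> p) \<partial>?MN) - 1
           - lan_exponent t * of_real ((K_fM g)^2 * \<epsilon>^10)) \<le> (\<integral>p. H p \<partial>?MN) * \<epsilon>^11"
    using c2 eventually_small_step eventually_at_right_0_small[of 1, simplified]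
  proof eventually_elim
    case (elim \<epsilon>)
    let ?r = "log_ratio \<epsilon>"
    have \<epsilon>: "0 < \<epsilon>" "\<epsilon> < 1" using elim(3) by auto
    have r1: "\<bar>?r p - \<epsilon>^5 * ?c p\<bar> \<le> \<epsilon>^6 * P p" for p
      by (intro order_trans[OF elim(1)[rule_format] mult_left_mono[OF dom(2)]]) simp
    have c: "\<bar>\<epsilon>^5 * ?c p\<bar> \<le> \<epsilon>^5 * P p" for p
      using \<epsilon> order_trans[OF c1 dom(1)] by (simp add: abs_mult)
    have e65: "\<epsilon>^6 * P p \<le> \<epsilon>^5 * P p" for p
      using \<epsilon> P0[of p] by (intro mult_right_mono power_decreasing) auto
    have r2: "\<bar>?r p\<bar> \<le> \<epsilon>^5 * (2 * P p)" for p
      using r1[of p] c[of p] e65[of p] by linarith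
    have sum: "\<bar>?r p + \<epsilon>^5 * ?c p\<bar> \<le> \<epsilon>^5 * (3 * P p)" for p
      using r2[of p] c[of p] by linarith
    have cube: "\<bar>?r p\<bar>^3 \<le> \<epsilon>^11 * (8 * P p ^ 3)" for p
    proof -
      have "\<bar>?r p\<bar>^3 \<le> (\<epsilon>^5 * (2 * P p))^3"
        by (intro power_mono r2) simp
      also have "(\<epsilon>^5 * (2 * P p))^3 = \<epsilon>^15 * (8 * P p ^ 3)"
        by (simp add: power_mult_distrib flip: power_mult)
      also have "\<dots> \<le> \<epsilon>^11 * (8 * P p ^ 3)"
        using \<epsilon> P0[of p] by (intro mult_right_mono power_decreasing) auto
      finally show ?thesis .
    qed
    have square: "\<bar>(?r p)^2 - \<epsilon>^10 * (?c p)^2\<bar> \<le> \<epsilon>^11 * (3 * P p ^ 2)" for p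
    proof -
      have "(?r p)^2 - \<epsilon>^10 * (?c p)^2 = (?r p - \<epsilon>^5 * ?c p) * (?r p + \<epsilon>^5 * ?c p)"
        by (simp add: algebra_simps eval_nat_numeral)
      then have "\<bar>(?r p)^2 - \<epsilon>^10 * (?c p)^2\<bar> \<le> (\<epsilon>^6 * P p) * (\<epsilon>^5 * (3 * P p))"
        using mult_mono[OF r1[of p] sum[of p]] P0[of p] \<epsilon> by (simp add: abs_mult)
      also have "\<dots> = \<epsilon>^11 * (3 * P p ^ 2)"
        by (simp add: eval_nat_numeral)
      finally show ?thesis .
    qed
    \<comment> \<open>replace first \<open>sym_char\<close> by its quadratic term, then \<open>R\<close> by its leading term\<close>
    have pt: "cmod (sym_char t (?r p) - lan_exponent t * of_real (\<epsilon>^10 * (?c p)^2)) \<le> H p * \<epsilon>^11" for p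
    proof -
      have "sym_char t (?r p) - lan_exponent t * of_real (\<epsilon>^10 * (?c p)^2)
          = (sym_char t (?r p) - lan_exponent t * of_real ((?r p)^2))
            + lan_exponent t * of_real ((?r p)^2 - \<epsilon>^10 * (?c p)^2)"
        by (simp add: algebra_simps)
      also have "cmod \<dots> \<le> C3 * \<bar>?r p\<bar>^3 + L * \<bar>(?r p)^2 - \<epsilon>^10 * (?c p)^2\<bar>"
        by (rule norm_triangle_mono[OF C3(2)]) (simp only: norm_mult L_def norm_of_real)
      also have "\<dots> \<le> C3 * (\<epsilon>^11 * (8 * P p ^ 3)) + L * (\<epsilon>^11 * (3 * P p ^ 2))"
        using C3(1) by (intro add_mono mult_left_mono cube square) (auto simp: L_def)
      also have "\<dots> = H p * \<epsilon>^11" by (simp add: H_def algebra_simps)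
      finally show ?thesis .
    qed
    have int_lim: "integrable ?MN (\<lambda>p. lan_exponent t * of_real (\<epsilon>^10 * (?c p)^2))"
      using c_int by (intro integrable_mult_right integrable_of_real) simp
    have int_diff: "integrable ?MN (\<lambda>p. sym_char t (?r p) - lan_exponent t * of_real (\<epsilon>^10 * (?c p)^2))"
    proof (rule Bochner_Integration.integrable_bound)
      show "integrable ?MN (\<lambda>p. H p * \<epsilon>^11)" using H_int by simp
      show "AE p in ?MN. cmod (sym_char t (?r p) - lan_exponent t * of_real (\<epsilon>^10 * (?c p)^2)) \<le> norm (H p * \<epsilon>^11)"
        using pt by (intro AE_I2) (metis abs_ge_self order_trans real_norm_def)
    qed measurable
    have int_sym: "integrable ?MN (\<lambda>p. sym_char t (?r p))"
      using Bochner_Integration.integrable_add[OF int_diff int_lim] by simp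
    have lim: "(\<integral>p. lan_exponent t * of_real (\<epsilon>^10 * (?c p)^2) \<partial>?MN) = lan_exponent t * of_real ((K_fM g)^2 * \<epsilon>^10)"
      unfolding K integral_mult_right_zero integral_complex_of_real by simp
    have eq: "(\<integral>p. iexp (t * ?r p) \<partial>?MN) - 1 - lan_exponent t * of_real ((K_fM g)^2 * \<epsilon>^10)
        = (\<integral>p. sym_char t (?r p) - lan_exponent t * of_real (\<epsilon>^10 * (?c p)^2) \<partial>?MN)"
      unfolding Bochner_Integration.integral_diff[OF int_sym int_lim] lim
      by (simp only: char_eq_integral_sym_char[OF elim(2)])
    have "cmod (\<integral>p. sym_char t (?r p) - lan_exponent t * of_real (\<epsilon>^10 * (?c p)^2) \<partial>?MN)
        \<le> (\<integral>p. H p * \<epsilon>^11 \<partial>?MN)"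
      using H_int int_diff pt by (intro Bochner_Integration.integral_norm_bound_integral) auto
    then show ?case unfolding eq by simp
  qed
  then show ?thesis by blast
qed

end

section \<open>Independent coordinates\<close>

interpretation lborel_family: product_sigma_finite "\<lambda>_::nat. lborel :: real measure"
  by (simp add: product_sigma_finite_def sigma_finite_lborel)

lemma sigma_finite_lborel_pow: "sigma_finite_measure (lborel_pow d)"
  by (rule lborel_family.sigma_finite) simp

lemma measurable_fst_coord: "i < d \<Longrightarrow> (\<lambda>w. fst w i) \<in> borel_measurable (lborel_pow d \<Otimes>\<^sub>M N)"
  by (rule measurable_compose[OF measurable_fst]) measurable

lemma measurable_snd_coord: "i < d \<Longrightarrow> (\<lambda>w. snd w i) \<in> borel_measurable (N \<Otimes>\<^sub>M lborel_pow d)"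
  by (rule measurable_compose[OF measurable_snd]) measurable

lemma nn_integral_lborel_pow_pair:
  fixes k :: "real \<Rightarrow> real \<Rightarrow> ennreal"
  assumes [measurable]: "case_prod k \<in> borel_measurable (borel \<Otimes>\<^sub>M borel)"
  shows "(\<integral>\<^sup>+x. \<integral>\<^sup>+y. (\<Prod>i<d. k (x i) (y i)) \<partial>lborel_pow d \<partial>lborel_pow d) = (\<integral>\<^sup>+x. \<integral>\<^sup>+y. k x y \<partial>lborel \<partial>lborel) ^ d"
proof -
  have "(\<integral>\<^sup>+y. (\<Prod>i<d. k (x i) (y i)) \<partial>lborel_pow d) = (\<Prod>i<d. \<integral>\<^sup>+y. k (x i) y \<partial>lborel)" for x
    by (rule lborel_family.product_nn_integral_prod) auto
  then have "(\<integral>\<^sup>+x. \<integral>\<^sup>+y. (\<Prod>i<d. k (x i) (y i)) \<partial>lborel_pow d \<partial>lborel_pow d)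
      = (\<integral>\<^sup>+x. (\<Prod>i<d. \<integral>\<^sup>+y. k (x i) y \<partial>lborel) \<partial>lborel_pow d)"
    by simp
  also have "\<dots> = (\<Prod>i<d. \<integral>\<^sup>+x. \<integral>\<^sup>+y. k x y \<partial>lborel \<partial>lborel)"
    by (rule lborel_family.product_nn_integral_prod) auto
  finally show ?thesis by simp
qed

text \<open>
  Integrability of every section, and not only of almost every one, is required because the inner
  product integral is formed at each fixed \<open>x\<close>. It holds below as each section is dominated by a
  normal density.
\<close>

lemma integral_lborel_pow_pair:
  fixes k :: "real \<Rightarrow> real \<Rightarrow> complex"
  assumes int: "integrable (lborel \<Otimes>\<^sub>M lborel) (case_prod k)" and sec: "\<And>x. integrable lborel (k x)"
  shows "(\<integral>x. \<integral>y. (\<Prod>i<d. k (x i) (y i)) \<partial>lborel_pow d \<partial>lborel_pow d) = (\<integral>p. case_prod k p \<partial>(lborel \<Otimes>\<^sub>M lborel)) ^ d"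
proof -
  interpret lborel_pair: pair_sigma_finite lborel "lborel :: real measure" ..
  have "(\<integral>y. (\<Prod>i<d. k (x i) (y i)) \<partial>lborel_pow d) = (\<Prod>i<d. \<integral>y. k (x i) y \<partial>lborel)" for x
    by (rule lborel_family.product_integral_prod) (auto simp: sec)
  then have "(\<integral>x. \<integral>y. (\<Prod>i<d. k (x i) (y i)) \<partial>lborel_pow d \<partial>lborel_pow d)
      = (\<integral>x. (\<Prod>i<d. \<integral>y. k (x i) y \<partial>lborel) \<partial>lborel_pow d)"
    by simp
  also have "\<dots> = (\<Prod>i<d. \<integral>x. \<integral>y. k x y \<partial>lborel \<partial>lborel)"
    using lborel_pair.integrable_fst[OF int] by (intro lborel_family.product_integral_prod) auto
  also have "\<dots> = (\<integral>p. case_prod k p \<partial>(lborel \<Otimes>\<^sub>M lborel)) ^ d"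
    using lborel_pair.integral_fst[OF int] by simp
  finally show ?thesis .
qed

context fmala_target
begin

lemma target_const_eq: "target_const g d = (1 / (\<integral>s. exp (g s) \<partial>lborel)) ^ d"
proof -
  have "(\<integral>x. (\<Prod>i<d. exp (g (x i))) \<partial>lborel_pow d) = (\<Prod>i<d. \<integral>s. exp (g s) \<partial>lborel)"
    by (rule lborel_family.product_integral_prod) (auto simp: integrable_exp_g)
  then show ?thesis by (simp add: target_const_def power_one_over)
qed

definition joint_prod :: "real \<Rightarrow> nat \<Rightarrow> (nat \<Rightarrow> real) \<Rightarrow> (nat \<Rightarrow> real) \<Rightarrow> real" where
  "joint_prod \<epsilon> d x y = (\<Prod>i<d. joint \<epsilon> (x i) (y i))"

definition total_log_ratio :: "real \<Rightarrow> nat \<Rightarrow> (nat \<Rightarrow> real) \<times> (nat \<Rightarrow> real) \<Rightarrow> real" where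
  "total_log_ratio \<epsilon> d w = (\<Sum>i<d. pair_log_ratio \<epsilon> (fst w i) (snd w i))"

lemma target_proposal_eq_joint_prod:
  "target_density g d x * fmala_density g (\<epsilon>^2) d x y = joint_prod \<epsilon> d x y"
  by (simp add: target_density_def fmala_density_def joint_prod_def joint_def target1_density_def
      target_const_eq prod.distrib prod_dividef power_one_over)

lemma joint_prod_pos: "small_step \<epsilon> \<Longrightarrow> 0 < joint_prod \<epsilon> d x y"
  unfolding joint_prod_def by (intro prod_pos) (auto intro: joint_pos)

lemma fmala_acc_eq:
  assumes "small_step \<epsilon>"
  shows "fmala_acc g (\<epsilon>^2) d x y = min 1 (exp (total_log_ratio \<epsilon> d (x, y)))"
proof -
  have "joint_prod \<epsilon> d y x = joint_prod \<epsilon> d x y * exp (total_log_ratio \<epsilon> d (x, y))"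
    unfolding joint_prod_def total_log_ratio_def
    by (simp add: joint_swap[OF assms, of "y _"] prod.distrib exp_sum)
  then show ?thesis
    using joint_prod_pos[OF assms, of d x y]
    by (simp add: fmala_acc_def target_proposal_eq_joint_prod)
qed

lemma measurable_joint_prod [measurable]:
  "(\<lambda>w. joint_prod \<epsilon> d (fst w) (snd w)) \<in> borel_measurable (lborel_pow d \<Otimes>\<^sub>M lborel_pow d)"
  unfolding joint_prod_def
  by (intro borel_measurable_prod measurable_joint measurable_fst_coord measurable_snd_coord) auto

lemma measurable_total_log_ratio [measurable]:
  "total_log_ratio \<epsilon> d \<in> borel_measurable (lborel_pow d \<Otimes>\<^sub>M lborel_pow d)"
  unfolding total_log_ratio_def
  by (intro borel_measurable_sum measurable_pair_log_ratio measurable_fst_coord measurable_snd_coord) auto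

definition joint_measure :: "real \<Rightarrow> nat \<Rightarrow> ((nat \<Rightarrow> real) \<times> (nat \<Rightarrow> real)) measure" where
  "joint_measure \<epsilon> d = density (lborel_pow d \<Otimes>\<^sub>M lborel_pow d) (\<lambda>w. ennreal (joint_prod \<epsilon> d (fst w) (snd w)))"

lemma nn_integral_joint: 
  assumes "small_step \<epsilon>" shows "(\<integral>\<^sup>+x. \<integral>\<^sup>+y. ennreal (joint \<epsilon> x y) \<partial>lborel \<partial>lborel) = 1"
proof -
  interpret prob_space "pair_law \<epsilon>" by (rule prob_space_pair_law[OF assms])
  have meas: "(\<lambda>(x, y). ennreal (joint \<epsilon> x y)) \<in> borel_measurable (lborel \<Otimes>\<^sub>M lborel)"
    unfolding case_prod_beta by measurable
  have "(\<integral>\<^sup>+x. \<integral>\<^sup>+y. ennreal (joint \<epsilon> x y) \<partial>lborel \<partial>lborel)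
      = (\<integral>\<^sup>+p. (case p of (x, y) \<Rightarrow> ennreal (joint \<epsilon> x y)) \<partial>(lborel \<Otimes>\<^sub>M lborel))"
    by (subst lborel.nn_integral_fst[symmetric]) (auto simp: case_prod_beta)
  also have "\<dots> = emeasure (pair_law \<epsilon>) (space (pair_law \<epsilon>))"
    unfolding pair_law_def space_density emeasure_density[OF meas sets.top]
    by (intro nn_integral_cong) simp
  finally show ?thesis by (simp add: emeasure_space_1)
qed

lemma nn_integral_joint_prod:
  assumes "small_step \<epsilon>"
  shows "(\<integral>\<^sup>+w. ennreal (joint_prod \<epsilon> d (fst w) (snd w)) \<partial>(lborel_pow d \<Otimes>\<^sub>M lborel_pow d)) = 1"
proof -
  interpret sigma_finite_measure "lborel_pow d" by (rule sigma_finite_lborel_pow)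
  have "(\<integral>\<^sup>+w. ennreal (joint_prod \<epsilon> d (fst w) (snd w)) \<partial>(lborel_pow d \<Otimes>\<^sub>M lborel_pow d))
      = (\<integral>\<^sup>+x. \<integral>\<^sup>+y. (\<Prod>i<d. ennreal (joint \<epsilon> (x i) (y i))) \<partial>lborel_pow d \<partial>lborel_pow d)"
    by (subst nn_integral_fst[symmetric])
      (auto simp: joint_prod_def prod_ennreal joint_pos[OF assms] less_imp_le)
  also have "\<dots> = 1"
    by (subst nn_integral_lborel_pow_pair) (auto simp: nn_integral_joint[OF assms])
  finally show ?thesis .
qed

lemma prob_space_joint_measure: "small_step \<epsilon> \<Longrightarrow> prob_space (joint_measure \<epsilon> d)"
  unfolding joint_measure_def
  by (rule prob_spaceI) (simp add: emeasure_density nn_integral_joint_prod cong: nn_integral_cong)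

lemma integrable_joint_prod_scaled:
  fixes F :: "_ \<Rightarrow> 'b::{banach, second_countable_topology}"
  assumes "small_step \<epsilon>" and [measurable]: "F \<in> borel_measurable (lborel_pow d \<Otimes>\<^sub>M lborel_pow d)"
    and "\<And>w. norm (F w) \<le> 1"
  shows "integrable (lborel_pow d \<Otimes>\<^sub>M lborel_pow d) (\<lambda>w. joint_prod \<epsilon> d (fst w) (snd w) *\<^sub>R F w)"
proof (rule Bochner_Integration.integrable_bound)
  show "integrable (lborel_pow d \<Otimes>\<^sub>M lborel_pow d) (\<lambda>w. joint_prod \<epsilon> d (fst w) (snd w))"
    using joint_prod_pos[OF assms(1), of d] nn_integral_joint_prod[OF assms(1), of d]
    by (intro integrableI_nonneg) (auto intro: less_imp_le)
  show "AE w in lborel_pow d \<Otimes>\<^sub>M lborel_pow d.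
     norm (joint_prod \<epsilon> d (fst w) (snd w) *\<^sub>R F w) \<le> norm (joint_prod \<epsilon> d (fst w) (snd w))"
    using assms(3) by (intro AE_I2) (simp add: mult_left_le)
qed measurable

definition total_law :: "real \<Rightarrow> nat \<Rightarrow> real measure" where
  "total_law \<epsilon> d = distr (joint_measure \<epsilon> d) borel (total_log_ratio \<epsilon> d)"

lemma sets_joint_measure [measurable_cong]: "sets (joint_measure \<epsilon> d) = sets (lborel_pow d \<Otimes>\<^sub>M lborel_pow d)"
  by (simp add: joint_measure_def)

lemma real_distribution_total_law: "small_step \<epsilon> \<Longrightarrow> real_distribution (total_law \<epsilon> d)"
  unfolding total_law_def
  by (rule prob_space.real_distribution_distr[OF prob_space_joint_measure]) measurable

text \<open>
  The iterated integral of the mean acceptance rate is an expectation under the law of the total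
  log ratio; boundedness of \<open>\<phi>\<close> gives the integrability needed for Fubini's theorem.
\<close>

lemma integral_total_law:
  fixes \<phi> :: "real \<Rightarrow> 'b::{banach, second_countable_topology}"
  assumes "small_step \<epsilon>" and [measurable]: "\<phi> \<in> borel_measurable borel" and bd: "\<And>s. norm (\<phi> s) \<le> 1"
  shows "(\<integral>s. \<phi> s \<partial>total_law \<epsilon> d)
       = (\<integral>x. \<integral>y. joint_prod \<epsilon> d x y *\<^sub>R \<phi> (total_log_ratio \<epsilon> d (x, y)) \<partial>lborel_pow d \<partial>lborel_pow d)"
proof -
  interpret pair_sigma_finite "lborel_pow d" "lborel_pow d"
    by (simp add: pair_sigma_finite_def sigma_finite_lborel_pow)
  have "(\<integral>s. \<phi> s \<partial>total_law \<epsilon> d) = (\<integral>w. \<phi> (total_log_ratio \<epsilon> d w) \<partial>joint_measure \<epsilon> d)"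
    unfolding total_law_def by (rule integral_distr) measurable
  also have "\<dots> = (\<integral>w. joint_prod \<epsilon> d (fst w) (snd w) *\<^sub>R \<phi> (total_log_ratio \<epsilon> d w) \<partial>(lborel_pow d \<Otimes>\<^sub>M lborel_pow d))"
    unfolding joint_measure_def
    by (rule integral_density) (auto simp: joint_prod_pos[OF assms(1)] less_imp_le)
  also have "\<dots> = (\<integral>x. \<integral>y. joint_prod \<epsilon> d x y *\<^sub>R \<phi> (total_log_ratio \<epsilon> d (x, y)) \<partial>lborel_pow d \<partial>lborel_pow d)"
    by (subst integral_fst'[symmetric]) (auto intro!: integrable_joint_prod_scaled assms(1) bd)
  finally show ?thesis .
qed

lemma char_total_law:
  assumes "small_step \<epsilon>"
  shows "char (total_law \<epsilon> d) t = (\<integral>p. iexp (t * log_ratio \<epsilon> p) \<partial>(target1 \<Otimes>\<^sub>M noise)) ^ d"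
proof -
  let ?k = "\<lambda>x y. joint \<epsilon> x y *\<^sub>R iexp (t * pair_log_ratio \<epsilon> x y)"
  have sec: "integrable lborel (?k x)" for x
  proof (rule Bochner_Integration.integrable_bound)
    show "integrable lborel (joint \<epsilon> x)"
      unfolding joint_def by (intro integrable_mult_right integrable_normal_density)
        (use assms in \<open>auto simp: small_step_def fmala_scale_eq\<close>)
    show "AE y in lborel. norm (?k x y) \<le> norm (joint \<epsilon> x y)" by simp
  qed measurable
  have int: "integrable (lborel \<Otimes>\<^sub>M lborel) (case_prod ?k)"
  proof (rule Bochner_Integration.integrable_bound)
    interpret prob_space "pair_law \<epsilon>" by (rule prob_space_pair_law[OF assms])
    show "integrable (lborel \<Otimes>\<^sub>M lborel) (\<lambda>(x, y). joint \<epsilon> x y)"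
    proof (rule integrableI_nonneg)
      show "(\<integral>\<^sup>+p. ennreal (case p of (x, y) \<Rightarrow> joint \<epsilon> x y) \<partial>(lborel \<Otimes>\<^sub>M lborel)) < \<infinity>"
        using nn_integral_joint[OF assms]
        by (subst lborel.nn_integral_fst[symmetric]) (auto simp: case_prod_beta)
    qed (auto simp: joint_pos[OF assms] less_imp_le case_prod_beta)
    show "AE p in lborel \<Otimes>\<^sub>M lborel. norm (case_prod ?k p) \<le> norm (case p of (x, y) \<Rightarrow> joint \<epsilon> x y)"
      by (auto simp: case_prod_beta)
  qed measurable
  have "char (total_law \<epsilon> d) t
      = (\<integral>x. \<integral>y. joint_prod \<epsilon> d x y *\<^sub>R iexp (t * total_log_ratio \<epsilon> d (x, y)) \<partial>lborel_pow d \<partial>lborel_pow d)"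
    unfolding char_def by (rule integral_total_law[OF assms]) auto
  also have "\<dots> = (\<integral>x. \<integral>y. (\<Prod>i<d. ?k (x i) (y i)) \<partial>lborel_pow d \<partial>lborel_pow d)"
    by (simp add: joint_prod_def total_log_ratio_def sum_distrib_left exp_sum scaleR_conv_of_real prod.distrib)
  also have "\<dots> = (\<integral>p. case_prod ?k p \<partial>(lborel \<Otimes>\<^sub>M lborel)) ^ d"
    by (rule integral_lborel_pow_pair[OF int sec])
  also have "(\<integral>p. case_prod ?k p \<partial>(lborel \<Otimes>\<^sub>M lborel)) = (\<integral>p. iexp (t * pair_log_ratio \<epsilon> (fst p) (snd p)) \<partial>pair_law \<epsilon>)"
    unfolding pair_law_def case_prod_beta
    by (rule integral_density[symmetric]) (auto simp: joint_pos[OF assms] less_imp_le)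
  also have "\<dots> = (\<integral>p. iexp (t * log_ratio \<epsilon> p) \<partial>(target1 \<Otimes>\<^sub>M noise))"
    by (rule integral_pair_law_log_ratio[OF assms]) measurable
  finally show ?thesis .
qed

lemma fmala_mean_acc_eq:
  assumes "small_step \<epsilon>" and "fmala_step l d = \<epsilon>^2"
  shows "fmala_mean_acc g l d = (\<integral>s. min 1 (exp s) \<partial>total_law \<epsilon> d)"
  unfolding fmala_mean_acc_def assms(2) target_proposal_eq_joint_prod fmala_acc_eq[OF assms(1)]
  by (subst integral_total_law[OF assms(1)]) (auto simp: min_def)

end

section \<open>The Gaussian limit\<close>

text \<open>
  In the closed unit disc the powers of \<open>w\<^sub>n\<close> and \<open>exp(a/n)\<close> differ by at most \<open>n \<bar>w\<^sub>n - exp(a/n)\<bar>\<close>.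
  Both \<open>n (w\<^sub>n - 1)\<close> and \<open>n (exp(a/n) - 1)\<close> tend to \<open>a\<close>, so this bound tends to \<open>0\<close>.
\<close>

lemma tendsto_power_exp_complex:
  fixes w :: "nat \<Rightarrow> complex"
  assumes lim: "(\<lambda>n. of_nat n * (w n - 1)) \<longlonglongrightarrow> a" and le1: "\<forall>\<^sub>F n in sequentially. cmod (w n) \<le> 1"
    and a: "Re a \<le> 0"
  shows "(\<lambda>n. w n ^ n) \<longlonglongrightarrow> exp a"
proof -
  have "((\<lambda>h. exp (h * a)) has_field_derivative a) (at 0)"
    by (auto intro!: derivative_eq_intros)
  then have "((\<lambda>h. (exp (h * a) - 1) / h) \<longlongrightarrow> a) (at 0)"
    by (simp add: DERIV_def)
  moreover have "filterlim (\<lambda>n. inverse (of_nat n) :: complex) (at 0) sequentially"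
    unfolding filterlim_at
    using lim_inverse_n[where 'a = complex]
    by (auto intro: eventually_sequentiallyI[of 1])
  ultimately have e: "(\<lambda>n. (exp (inverse (of_nat n) * a) - 1) / inverse (of_nat n)) \<longlonglongrightarrow> a"
    by (rule filterlim_compose)
  have "(\<lambda>n. of_nat n * (w n - 1) - (exp (inverse (of_nat n) * a) - 1) / inverse (of_nat n)) \<longlonglongrightarrow> 0"
    using tendsto_diff[OF lim e] by simp
  then have "(\<lambda>n. cmod (of_nat n * (w n - 1) - (exp (inverse (of_nat n) * a) - 1) / inverse (of_nat n))) \<longlonglongrightarrow> 0"
    by (rule tendsto_norm_zero)
  then have "(\<lambda>n. w n ^ n - exp a) \<longlonglongrightarrow> 0"
  proof (rule Lim_null_comparison[rotated])
    show "\<forall>\<^sub>F n in sequentially. norm (w n ^ n - exp a)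
        \<le> cmod (of_nat n * (w n - 1) - (exp (inverse (of_nat n) * a) - 1) / inverse (of_nat n))"
      using le1 eventually_ge_at_top[of 1]
    proof eventually_elim
      case (elim n)
      let ?v = "exp (inverse (of_nat n) * a)"
      have "cmod ?v \<le> 1"
        using a elim(2) by (simp add: norm_exp_eq_Re divide_inverse[symmetric] mult.commute field_simps)
      moreover have "?v ^ n = exp a"
        using elim(2) by (simp add: exp_of_nat_mult[symmetric] field_simps)
      ultimately have "cmod (w n ^ n - exp a) \<le> n * cmod (w n - ?v)"
        using norm_power_diff[OF elim(1), of ?v n] by simp
      also have "\<dots> = cmod (of_nat n * (w n - ?v))" by (simp add: norm_mult)
      also have "of_nat n * (w n - ?v) = of_nat n * (w n - 1) - (?v - 1) / inverse (of_nat n)"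
        by (simp add: algebra_simps divide_inverse)
      finally show ?case .
    qed
  qed
  then show ?thesis by (simp add: LIM_zero_iff)
qed

text \<open>
  The Gaussian law with mean \<open>-\<sigma>\<^sup>2/2\<close> and variance \<open>\<sigma>\<^sup>2\<close>, written as an image of the standard one so that
  the degenerate case \<open>\<sigma> = 0\<close> is included.
\<close>

definition limit_law :: "real \<Rightarrow> real measure" where
  "limit_law \<sigma> = distr std_normal_distribution borel (\<lambda>z. \<sigma> * z - \<sigma>^2 / 2)"

lemma real_distribution_limit_law: "real_distribution (limit_law \<sigma>)"
  unfolding limit_law_def
  by (rule prob_space.real_distribution_distr[OF prob_space_normal_density]) auto

lemma char_limit_law: "char (limit_law \<sigma>) t = exp (lan_exponent t * of_real (\<sigma>^2))"
proof -
  have "char (limit_law \<sigma>) t = (\<integral>z. iexp (- (t * \<sigma>^2 / 2)) * iexp ((t * \<sigma>) * z) \<partial>std_normal_distribution)"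
    unfolding char_def limit_law_def
    by (subst integral_distr) (auto intro!: Bochner_Integration.integral_cong simp: exp_add[symmetric] algebra_simps)
  also have "\<dots> = iexp (- (t * \<sigma>^2 / 2)) * char std_normal_distribution (t * \<sigma>)"
    by (simp add: char_def)
  also have "\<dots> = exp (\<i> * of_real (- (t * \<sigma>^2 / 2)) + of_real (- ((t * \<sigma>)^2) / 2))"
    by (simp only: char_std_normal_distribution exp_add exp_of_real)
  also have "\<i> * of_real (- (t * \<sigma>^2 / 2)) + of_real (- ((t * \<sigma>)^2) / 2) = lan_exponent t * of_real (\<sigma>^2)"
    by (simp add: lan_exponent_def power_mult_distrib field_simps)
  finally show ?thesis .
qed

lemma Phi_eq: "Phi t = (\<integral>s. indicator {..t} s * std_normal_density s \<partial>lborel)"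
  by (simp add: Phi_def set_lebesgue_integral_def std_normal_density_def mult_ac
      flip: Bochner_Integration.integral_mult_right_zero)

text \<open>
  The weight \<open>exp(\<sigma>z - \<sigma>\<^sup>2/2)\<close> is at least \<open>1\<close> for \<open>z \<ge> \<sigma>/2\<close>, and multiplying the standard Gaussian
  density by it shifts that density by \<open>\<sigma>\<close>. Each of the two half-lines contributes \<open>\<Phi>(-\<sigma>/2)\<close>.
\<close>

lemma expectation_min_limit_law:
  assumes "0 \<le> \<sigma>"
  shows "(\<integral>s. min 1 (exp s) \<partial>limit_law \<sigma>) = 2 * Phi (- \<sigma> / 2)"
proof -
  let ?n = std_normal_density
  have [simp]: "integrable lborel ?n" by simp
  have shift_int: "integrable lborel (\<lambda>z. ?n (z - \<sigma>))"
    using lborel_integrable_real_affine[of ?n 1 "- \<sigma>"] by simp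
  have split: "?n z * min 1 (exp (\<sigma> * z - \<sigma>^2 / 2))
      = indicator {\<sigma> / 2..} z * ?n z + indicator {..<\<sigma> / 2} z * ?n (z - \<sigma>)" for z
  proof (cases "\<sigma> / 2 \<le> z")
    case True
    then have "\<sigma> * (\<sigma> / 2) \<le> \<sigma> * z" using assms by (intro mult_left_mono) auto
    then show ?thesis using True by (simp add: power2_eq_square min_def)
  next
    case False
    then have "\<sigma> * z \<le> \<sigma> * (\<sigma> / 2)" using assms by (intro mult_left_mono) auto
    then have "min 1 (exp (\<sigma> * z - \<sigma>^2 / 2)) = exp (\<sigma> * z - \<sigma>^2 / 2)"
      by (simp add: power2_eq_square min_def)
    moreover have "?n z * exp (\<sigma> * z - \<sigma>^2 / 2) = ?n (z - \<sigma>)"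
      by (simp add: std_normal_density_def exp_add[symmetric] power2_eq_square field_simps)
    ultimately show ?thesis using False by simp
  qed
  have "(\<integral>s. min 1 (exp s) \<partial>limit_law \<sigma>) = (\<integral>z. ?n z * min 1 (exp (\<sigma> * z - \<sigma>^2 / 2)) \<partial>lborel)"
    unfolding limit_law_def
    by (subst integral_distr) (auto simp: integral_density)
  also have "\<dots> = (\<integral>z. indicator {\<sigma> / 2..} z * ?n z \<partial>lborel) + (\<integral>z. indicator {..<\<sigma> / 2} z * ?n (z - \<sigma>) \<partial>lborel)"
    unfolding split
    using integrable_mult_indicator[of "{\<sigma> / 2..}" lborel ?n]
      integrable_mult_indicator[OF _ shift_int, of "{..<\<sigma> / 2}"]
    by (intro Bochner_Integration.integral_add) simp_all
  also have "(\<integral>z. indicator {\<sigma> / 2..} z * ?n z \<partial>lborel) = Phi (- \<sigma> / 2)"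
    unfolding Phi_eq
    by (subst lborel_integral_real_affine[of "-1" _ 0])
       (auto intro!: Bochner_Integration.integral_cong simp: indicator_def std_normal_density_def)
  also have "(\<integral>z. indicator {..<\<sigma> / 2} z * ?n (z - \<sigma>) \<partial>lborel) = (\<integral>z. indicator {..<- \<sigma> / 2} z * ?n z \<partial>lborel)"
    by (subst lborel_integral_real_affine[of 1 _ \<sigma>])
       (auto intro!: Bochner_Integration.integral_cong simp: indicator_def)
  also have "\<dots> = Phi (- \<sigma> / 2)"
    unfolding Phi_eq
  proof (rule integral_cong_AE)
    show "AE z in lborel. indicator {..<- \<sigma> / 2} z * ?n z = indicator {..- \<sigma> / 2} z * ?n z"
      using AE_lborel_singleton[of "- \<sigma> / 2"] by eventually_elim (auto simp: indicator_def)
  qed auto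
  finally show ?thesis by simp
qed

theorem theorem3p1:
  fixes g :: "real \<Rightarrow> real" and l :: real
  assumes "Ck_real 10 g"
    and "bounded (range ((deriv ^^ 2) g))"
    and "\<exists>C \<kappa> :: real. \<forall>t. \<forall>i\<in>{1..10}. \<bar>(deriv ^^ i) g t\<bar> \<le> C * (1 + \<bar>t\<bar> powr \<kappa>)"
    and "\<And>k :: nat. integrable lborel (\<lambda>t. t ^ k * exp (g t))"
    and "l > 0"
  shows "(\<lambda>d. fmala_mean_acc g l d) \<longlonglongrightarrow> 2 * Phi (- K_fM g * l ^ 5 / 2)"
proof -
  interpret fmala_target g
    by (rule fmala_target.intro) (fact assms)+
  \<comment> \<open>the square root of the step, so that \<open>d \<epsilon>\<^sup>1\<^sup>0 = l\<^sup>1\<^sup>0\<close>\<close>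
  define \<epsilon> where "\<epsilon> d = l * real d powr (- 1 / 10)" for d
  define \<sigma> where "\<sigma> = K_fM g * l ^ 5"
  have K: "0 \<le> K_fM g" unfolding K_fM_def by (intro real_sqrt_ge_zero integral_nonneg_AE) auto
  then have \<sigma>: "0 \<le> \<sigma>" using assms(5) by (simp add: \<sigma>_def)
  have "filterlim (\<lambda>d. \<epsilon> d) (at_right 0) sequentially"
    unfolding \<epsilon>_def filterlim_at using assms(5)
    by (auto intro!: eventually_sequentiallyI[of 1] tendsto_mult_right_zero tendsto_neg_powr filterlim_real_sequentially)
  then have ev: "\<forall>\<^sub>F d in sequentially. P (\<epsilon> d)" if "\<forall>\<^sub>F e in at_right 0. P e" for P
    using that by (rule eventually_compose_filterlim[rotated])
  have \<epsilon>0: "\<epsilon> \<longlonglongrightarrow> 0"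
    unfolding \<epsilon>_def
    by (auto intro!: tendsto_mult_right_zero tendsto_neg_powr filterlim_real_sequentially)
  have step: "fmala_step l d = (\<epsilon> d)^2" for d
    by (cases "d = 0") (simp_all add: fmala_step_def \<epsilon>_def power_mult_distrib powr_power)
  have \<epsilon>10: "real d * (\<epsilon> d)^10 = l^10" if "1 \<le> d" for d
    using that by (simp add: \<epsilon>_def power_divide powr_power powr_minus_divide)
  define \<phi> where "\<phi> t d = (\<integral>p. iexp (t * log_ratio (\<epsilon> d) p) \<partial>(target1 \<Otimes>\<^sub>M noise))" for t d
  have \<phi>_le1: "cmod (\<phi> t d) \<le> 1" for t d
  proof -
    have "cmod (\<phi> t d) \<le> (\<integral>p. cmod (iexp (t * log_ratio (\<epsilon> d) p)) \<partial>(target1 \<Otimes>\<^sub>M noise))"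
      unfolding \<phi>_def by (rule integral_norm_bound)
    then show ?thesis by (simp add: start.prob_space)
  qed
  have char_lim: "(\<lambda>d. \<phi> t d ^ d) \<longlonglongrightarrow> char (limit_law \<sigma>) t" for t
    unfolding char_limit_law
  proof (rule tendsto_power_exp_complex)
    obtain C where C: "\<forall>\<^sub>F e in at_right 0.
     cmod ((\<integral>p. iexp (t * log_ratio e p) \<partial>(target1 \<Otimes>\<^sub>M noise)) - 1
           - lan_exponent t * of_real ((K_fM g)^2 * e^10)) \<le> C * e^11"
      using one_coordinate_char by blast
    have "(\<lambda>d. of_nat d * (\<phi> t d - 1) - lan_exponent t * of_real (\<sigma>^2)) \<longlonglongrightarrow> 0"
    proof (rule Lim_null_comparison)
      show "(\<lambda>d. C * l^10 * \<epsilon> d) \<longlonglongrightarrow> 0"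
        using \<epsilon>0 by (rule tendsto_mult_right_zero)
      show "\<forall>\<^sub>F d in sequentially. norm (of_nat d * (\<phi> t d - 1) - lan_exponent t * of_real (\<sigma>^2)) \<le> C * l^10 * \<epsilon> d"
        using ev[OF C] eventually_ge_at_top[of 1]
      proof eventually_elim
        case (elim d)
        have "\<sigma>^2 = real d * ((K_fM g)^2 * (\<epsilon> d)^10)"
          using \<epsilon>10[OF elim(2)] by (simp add: \<sigma>_def power_mult_distrib mult.left_commute flip: power_mult)
        then have "of_nat d * (\<phi> t d - 1) - lan_exponent t * of_real (\<sigma>^2)
            = of_nat d * (\<phi> t d - 1 - lan_exponent t * of_real ((K_fM g)^2 * (\<epsilon> d)^10))"
          by (simp add: algebra_simps)
        then have "norm (of_nat d * (\<phi> t d - 1) - lan_exponent t * of_real (\<sigma>^2))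
            = real d * cmod (\<phi> t d - 1 - lan_exponent t * of_real ((K_fM g)^2 * (\<epsilon> d)^10))"
          by (simp only: norm_mult norm_of_nat)
        also have "\<dots> \<le> real d * (C * (\<epsilon> d)^11)"
          using elim(1) unfolding \<phi>_def by (rule mult_left_mono) simp
        also have "\<dots> = C * (real d * (\<epsilon> d)^10) * \<epsilon> d"
          by (simp add: eval_nat_numeral)
        finally show ?case unfolding \<epsilon>10[OF elim(2)] .
      qed
    qed
    then show "(\<lambda>d. of_nat d * (\<phi> t d - 1)) \<longlonglongrightarrow> lan_exponent t * of_real (\<sigma>^2)"
      by (simp add: LIM_zero_iff)
    show "\<forall>\<^sub>F d in sequentially. cmod (\<phi> t d) \<le> 1" by (simp add: \<phi>_le1)
    show "Re (lan_exponent t * of_real (\<sigma>^2)) \<le> 0"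
      by (simp add: lan_exponent_def)
  qed
  \<comment> \<open>in low dimension the scales may fail to be positive, so the sequence of laws starts at \<open>N\<close>\<close>
  obtain N where N: "\<And>d. N \<le> d \<Longrightarrow> small_step (\<epsilon> d)"
    using ev[OF eventually_small_step] unfolding eventually_sequentially by blast
  have "weak_conv_m (\<lambda>n. total_law (\<epsilon> (n + N)) (n + N)) (limit_law \<sigma>)"
  proof (rule levy_continuity)
    show "(\<lambda>n. char (total_law (\<epsilon> (n + N)) (n + N)) t) \<longlonglongrightarrow> char (limit_law \<sigma>) t" for t
      using LIMSEQ_ignore_initial_segment[OF char_lim[of t], of N]
      by (simp add: char_total_law N \<phi>_def)
  qed (simp_all add: real_distribution_total_law real_distribution_limit_law N)
  then have "(\<lambda>n. \<integral>s. min 1 (exp s) \<partial>total_law (\<epsilon> (n + N)) (n + N)) \<longlonglongrightarrow> (\<integral>s. min 1 (exp s) \<partial>limit_law \<sigma>)"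
  proof (rule weak_conv_imp_integral_bdd_continuous_conv[where B = 1, rotated 2])
    show "isCont (\<lambda>s::real. min 1 (exp s)) x" for x by (intro continuous_intros)
    show "norm (min 1 (exp s)) \<le> 1" for s :: real by (simp add: min_def)
  qed (simp_all add: real_distribution_total_law real_distribution_limit_law N)
  then have "(\<lambda>n. fmala_mean_acc g l (n + N)) \<longlonglongrightarrow> 2 * Phi (- \<sigma> / 2)"
    by (simp add: fmala_mean_acc_eq[OF N step] expectation_min_limit_law[OF \<sigma>])
  then show ?thesis
    unfolding \<sigma>_def by (simp add: LIMSEQ_ignore_initial_segment LIMSEQ_offset)
qed

end
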